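(* Let $\mathcal X$ be a locally $\kappa$-presentable category, for a regular cardinal $\kappa$, and consider the fibration of endofunctor algebras restricted to the $\kappa$-accessible functors $\mathcal X\to\mathcal X$. Then each reindexing has a left adjoint; that is, for every natural transformation $\alpha:F\Rightarrow G$ between $\kappa$-accessible endofunctors of $\mathcal X$, the functor $\alpha^*:\mathsf{Alg}(G)\to\mathsf{Alg}(F)$ has a left adjoint.
   Context: For an endofunctor $F:\mathcal X\to\mathcal X$, $\mathsf{Alg}(F)$ is the category of endofunctor algebras: objects are pairs $(X,\xi:FX\to X)$, and morphisms $(X,\xi)\to(Y,\theta)$ are morphisms $g:X\to Y$ with $g\circ\xi=\theta\circ Fg$. The assignment $F\mapsto\mathsf{Alg}(F)$ is contravariantly functorial, and its Grothendieck construction is the (universal) fibration of endofunctor algebras over the category of endofunctors of $\mathcal X$. Reindexing along $\alpha:F\Rightarrow G$ is the functor $\alpha^*:\mathsf{Alg}(G)\to\mathsf{Alg}(F)$, $(Y,\zeta:GY\to Y)\mapsto(Y,\zeta\circ\alpha_Y:FY\to Y)$, acting as the identity on underlying morphisms. An endofunctor is $\kappa$-accessible if it preserves $\kappa$-filtered colimits. *)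

theory Defs
  imports Main "HOL-Library.FuncSet"
begin

unbundle cardinal_syntax

section \<open>Categories, functors, natural transformations, adjunctions\<close>

text \<open>\<open>Comp C g f\<close> is the composite \<open>g \<circ> f\<close>. All operations are unconstrained
  outside the sets of objects and arrows.\<close>

record ('o, 'a) cat =
  Obj :: "'o set"
  Arr :: "'a set"
  Dom :: "'a \<Rightarrow> 'o"
  Cod :: "'a \<Rightarrow> 'o"
  Id :: "'o \<Rightarrow> 'a"
  Comp :: "'a \<Rightarrow> 'a \<Rightarrow> 'a"

definition Hom :: "('o, 'a) cat \<Rightarrow> 'o \<Rightarrow> 'o \<Rightarrow> 'a set" where
  "Hom C x y = {f \<in> Arr C. Dom C f = x \<and> Cod C f = y}"

locale category =
  fixes C :: "('o, 'a) cat"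
  assumes Dom_Obj: "f \<in> Arr C \<Longrightarrow> Dom C f \<in> Obj C"
    and Cod_Obj: "f \<in> Arr C \<Longrightarrow> Cod C f \<in> Obj C"
    and Id_Hom: "x \<in> Obj C \<Longrightarrow> Id C x \<in> Hom C x x"
    and Comp_Hom: "f \<in> Hom C x y \<Longrightarrow> g \<in> Hom C y z \<Longrightarrow> Comp C g f \<in> Hom C x z"
    and Comp_Id: "f \<in> Hom C x y \<Longrightarrow> Comp C f (Id C x) = f"
    and Id_Comp: "f \<in> Hom C x y \<Longrightarrow> Comp C (Id C y) f = f"
    and Comp_assoc: "f \<in> Hom C w x \<Longrightarrow> g \<in> Hom C x y \<Longrightarrow> h \<in> Hom C y z \<Longrightarrow>
      Comp C h (Comp C g f) = Comp C (Comp C h g) f"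

record ('o, 'a, 'p, 'b) fctr =
  FO :: "'o \<Rightarrow> 'p"
  FA :: "'a \<Rightarrow> 'b"

definition is_functor ::
  "('o, 'a) cat \<Rightarrow> ('p, 'b) cat \<Rightarrow> ('o, 'a, 'p, 'b) fctr \<Rightarrow> bool" where
  "is_functor C D F \<longleftrightarrow> category C \<and> category D \<and>
    (\<forall>x\<in>Obj C. FO F x \<in> Obj D) \<and>
    (\<forall>x y. \<forall>f\<in>Hom C x y. FA F f \<in> Hom D (FO F x) (FO F y)) \<and>
    (\<forall>x\<in>Obj C. FA F (Id C x) = Id D (FO F x)) \<and>
    (\<forall>x y z. \<forall>f\<in>Hom C x y. \<forall>g\<in>Hom C y z. FA F (Comp C g f) = Comp D (FA F g) (FA F f))"

definition id_functor :: "('o, 'a, 'o, 'a) fctr" where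
  "id_functor = \<lparr>FO = (\<lambda>x. x), FA = (\<lambda>f. f)\<rparr>"

definition comp_functor ::
  "('p, 'b, 'q, 'c) fctr \<Rightarrow> ('o, 'a, 'p, 'b) fctr \<Rightarrow> ('o, 'a, 'q, 'c) fctr" where
  "comp_functor G F = \<lparr>FO = FO G \<circ> FO F, FA = FA G \<circ> FA F\<rparr>"

definition nat_trans ::
  "('o, 'a) cat \<Rightarrow> ('p, 'b) cat \<Rightarrow> ('o, 'a, 'p, 'b) fctr \<Rightarrow> ('o, 'a, 'p, 'b) fctr \<Rightarrow>
    ('o \<Rightarrow> 'b) \<Rightarrow> bool" where
  "nat_trans C D F G \<alpha> \<longleftrightarrow> is_functor C D F \<and> is_functor C D G \<and>
    (\<forall>x\<in>Obj C. \<alpha> x \<in> Hom D (FO F x) (FO G x)) \<and>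
    (\<forall>x y. \<forall>f\<in>Hom C x y. Comp D (\<alpha> y) (FA F f) = Comp D (FA G f) (\<alpha> x))"

definition adjunction ::
  "('o, 'a) cat \<Rightarrow> ('p, 'b) cat \<Rightarrow> ('o, 'a, 'p, 'b) fctr \<Rightarrow> ('p, 'b, 'o, 'a) fctr \<Rightarrow>
    ('o \<Rightarrow> 'a) \<Rightarrow> ('p \<Rightarrow> 'b) \<Rightarrow> bool" where
  "adjunction C D L R \<eta> \<epsilon> \<longleftrightarrow> is_functor C D L \<and> is_functor D C R \<and>
    nat_trans C C id_functor (comp_functor R L) \<eta> \<and>
    nat_trans D D (comp_functor L R) id_functor \<epsilon> \<and>
    (\<forall>x\<in>Obj C. Comp D (\<epsilon> (FO L x)) (FA L (\<eta> x)) = Id D (FO L x)) \<and>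
    (\<forall>y\<in>Obj D. Comp C (FA R (\<epsilon> y)) (\<eta> (FO R y)) = Id C (FO R y))"

definition has_left_adjoint ::
  "('p, 'b) cat \<Rightarrow> ('o, 'a) cat \<Rightarrow> ('p, 'b, 'o, 'a) fctr \<Rightarrow> bool" where
  "has_left_adjoint D C R \<longleftrightarrow> (\<exists>L \<eta> \<epsilon>. adjunction C D L R \<eta> \<epsilon>)"

section \<open>Colimits\<close>

definition is_cocone ::
  "('j, 'i) cat \<Rightarrow> ('o, 'a) cat \<Rightarrow> ('j, 'i, 'o, 'a) fctr \<Rightarrow> 'o \<Rightarrow> ('j \<Rightarrow> 'a) \<Rightarrow> bool" where
  "is_cocone J C D c \<iota> \<longleftrightarrow> is_functor J C D \<and> c \<in> Obj C \<and>
    (\<forall>j\<in>Obj J. \<iota> j \<in> Hom C (FO D j) c) \<and>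
    (\<forall>j k. \<forall>u\<in>Hom J j k. Comp C (\<iota> k) (FA D u) = \<iota> j)"

definition is_colimit ::
  "('j, 'i) cat \<Rightarrow> ('o, 'a) cat \<Rightarrow> ('j, 'i, 'o, 'a) fctr \<Rightarrow> 'o \<Rightarrow> ('j \<Rightarrow> 'a) \<Rightarrow> bool" where
  "is_colimit J C D c \<iota> \<longleftrightarrow> is_cocone J C D c \<iota> \<and>
    (\<forall>d \<mu>. is_cocone J C D d \<mu> \<longrightarrow>
      (\<exists>!h. h \<in> Hom C c d \<and> (\<forall>j\<in>Obj J. Comp C h (\<iota> j) = \<mu> j)))"

section \<open>Smallness and locally presentable categories\<close>

text \<open>Size is measured by a cardinal \<open>U\<close> on a type \<open>'u\<close>: a set is \<open>U\<close>-small if its cardinality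
  is \<open>< U\<close>. When \<open>U\<close> is strongly inaccessible these are the small sets of a Grothendieck
  universe; none of the definitions requires it.
  Every \<open>U\<close>-small category is isomorphic to one whose objects and arrows are elements of \<open>'u\<close>,
  so quantifying over \<open>('u, 'u) cat\<close> covers all \<open>U\<close>-small shapes.\<close>

definition small_cat :: "'u rel \<Rightarrow> ('u, 'u) cat \<Rightarrow> bool" where
  "small_cat U J \<longleftrightarrow> category J \<and> |Arr J| <o U"

definition locally_small :: "'u rel \<Rightarrow> ('o, 'a) cat \<Rightarrow> bool" where
  "locally_small U C \<longleftrightarrow> (\<forall>x\<in>Obj C. \<forall>y\<in>Obj C. |Hom C x y| <o U)"

definition cocomplete :: "'u rel \<Rightarrow> ('o, 'a) cat \<Rightarrow> bool" where
  "cocomplete U C \<longleftrightarrow>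
    (\<forall>J D. small_cat U J \<and> is_functor J C D \<longrightarrow> (\<exists>c \<iota>. is_colimit J C D c \<iota>))"

text \<open>\<open>J\<close> is \<open>\<kappa>\<close>-filtered if every diagram in \<open>J\<close> with fewer than \<open>\<kappa>\<close> arrows has a cocone.
  The shapes \<open>I\<close> are again taken in \<open>'u\<close>; this is no restriction for \<open>\<kappa> \<le> |'u|\<close>.\<close>

definition filtered :: "'k rel \<Rightarrow> ('u, 'u) cat \<Rightarrow> bool" where
  "filtered \<kappa> J \<longleftrightarrow> category J \<and>
    (\<forall>(I :: ('u, 'u) cat) D. category I \<and> |Arr I| <o \<kappa> \<and> is_functor I J D \<longrightarrow>
      (\<exists>c \<iota>. is_cocone I J D c \<iota>))"

definition preserves_filtered_colimits ::
  "'u rel \<Rightarrow> 'k rel \<Rightarrow> ('o, 'a) cat \<Rightarrow> ('p, 'b) cat \<Rightarrow> ('o, 'a, 'p, 'b) fctr \<Rightarrow> bool" where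
  "preserves_filtered_colimits U \<kappa> C D F \<longleftrightarrow>
    (\<forall>(J :: ('u, 'u) cat) X c \<iota>. small_cat U J \<and> filtered \<kappa> J \<and> is_colimit J C X c \<iota> \<longrightarrow>
      is_colimit J D (comp_functor F X) (FO F c) (\<lambda>j. FA F (\<iota> j)))"

definition accessible_functor ::
  "'u rel \<Rightarrow> 'k rel \<Rightarrow> ('o, 'a) cat \<Rightarrow> ('p, 'b) cat \<Rightarrow> ('o, 'a, 'p, 'b) fctr \<Rightarrow> bool" where
  "accessible_functor U \<kappa> C D F \<longleftrightarrow>
    is_functor C D F \<and> preserves_filtered_colimits U \<kappa> C D F"

text \<open>The category of \<open>U\<close>-small sets with elements in \<open>'e\<close>. An arrow is a triple of domain,
  function and codomain; the function is \<^const>\<open>undefined\<close> outside the domain.\<close>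

definition set_cat :: "'u rel \<Rightarrow> ('e set, 'e set \<times> ('e \<Rightarrow> 'e) \<times> 'e set) cat" where
  "set_cat U = \<lparr>
    Obj = {A. |A| <o U},
    Arr = {(A, f, B). |A| <o U \<and> |B| <o U \<and> f \<in> A \<rightarrow>\<^sub>E B},
    Dom = (\<lambda>(A, f, B). A),
    Cod = (\<lambda>(A, f, B). B),
    Id = (\<lambda>A. (A, restrict (\<lambda>x. x) A, A)),
    Comp = (\<lambda>(B', g, B) (A, f, A'). (A, compose A g f, B))\<rparr>"

text \<open>Hom-sets are injected into \<open>'a + 'u\<close>, because every \<open>U\<close>-small set is in bijection
  with a set over that type, so that \<open>set_cat U\<close> over \<open>'a + 'u\<close> is equivalent to the
  category of all \<open>U\<close>-small sets.\<close>

definition hom_functor ::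
  "'u rel \<Rightarrow> ('o, 'a) cat \<Rightarrow> 'o \<Rightarrow>
    ('o, 'a, ('a + 'u) set, ('a + 'u) set \<times> ('a + 'u \<Rightarrow> 'a + 'u) \<times> ('a + 'u) set) fctr" where
  "hom_functor U C a = \<lparr>
    FO = (\<lambda>x. Inl ` Hom C a x),
    FA = (\<lambda>f. (Inl ` Hom C a (Dom C f),
               restrict (\<lambda>s. Inl (Comp C f (projl s))) (Inl ` Hom C a (Dom C f)),
               Inl ` Hom C a (Cod C f)))\<rparr>"

definition presentable_object :: "'u rel \<Rightarrow> 'k rel \<Rightarrow> ('o, 'a) cat \<Rightarrow> 'o \<Rightarrow> bool" where
  "presentable_object U \<kappa> C a \<longleftrightarrow> a \<in> Obj C \<and>
    preserves_filtered_colimits U \<kappa> C (set_cat U) (hom_functor U C a)"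

definition locally_presentable :: "'u rel \<Rightarrow> 'k rel \<Rightarrow> ('o, 'a) cat \<Rightarrow> bool" where
  "locally_presentable U \<kappa> C \<longleftrightarrow>
    category C \<and> locally_small U C \<and> cocomplete U C \<and>
    (\<exists>S \<subseteq> Obj C. |S| <o U \<and> (\<forall>a\<in>S. presentable_object U \<kappa> C a) \<and>
      (\<forall>x\<in>Obj C. \<exists>(J :: ('u, 'u) cat) D \<iota>. small_cat U J \<and> filtered \<kappa> J \<and>
        (\<forall>j\<in>Obj J. FO D j \<in> S) \<and> is_colimit J C D x \<iota>))"

section \<open>Endofunctor algebras\<close>

text \<open>Morphisms carry their source and target algebra, since one underlying arrow may be a
  morphism between several pairs of algebras.\<close>

definition Alg ::
  "('o, 'a) cat \<Rightarrow> ('o, 'a, 'o, 'a) fctr \<Rightarrow>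
    ('o \<times> 'a, ('o \<times> 'a) \<times> 'a \<times> ('o \<times> 'a)) cat" where
  "Alg C F = \<lparr>
    Obj = {(X, \<xi>). X \<in> Obj C \<and> \<xi> \<in> Hom C (FO F X) X},
    Arr = {((X, \<xi>), g, (Y, \<theta>)) | X \<xi> g Y \<theta>.
      X \<in> Obj C \<and> \<xi> \<in> Hom C (FO F X) X \<and> Y \<in> Obj C \<and> \<theta> \<in> Hom C (FO F Y) Y \<and>
      g \<in> Hom C X Y \<and> Comp C g \<xi> = Comp C \<theta> (FA F g)},
    Dom = (\<lambda>(A, g, B). A),
    Cod = (\<lambda>(A, g, B). B),
    Id = (\<lambda>A. (A, Id C (fst A), A)),
    Comp = (\<lambda>(B', h, B) (A, g, A'). (A, Comp C h g, B))\<rparr>"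

definition reindex_obj :: "('o, 'a) cat \<Rightarrow> ('o \<Rightarrow> 'a) \<Rightarrow> 'o \<times> 'a \<Rightarrow> 'o \<times> 'a" where
  "reindex_obj C \<alpha> = (\<lambda>(Y, \<zeta>). (Y, Comp C \<zeta> (\<alpha> Y)))"

definition reindex ::
  "('o, 'a) cat \<Rightarrow> ('o \<Rightarrow> 'a) \<Rightarrow>
    ('o \<times> 'a, ('o \<times> 'a) \<times> 'a \<times> ('o \<times> 'a), 'o \<times> 'a, ('o \<times> 'a) \<times> 'a \<times> ('o \<times> 'a)) fctr" where
  "reindex C \<alpha> = \<lparr>
    FO = reindex_obj C \<alpha>,
    FA = (\<lambda>(A, g, B). (reindex_obj C \<alpha> A, g, reindex_obj C \<alpha> B))\<rparr>"

section \<open>Well-definedness\<close>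

lemma category_set_cat: "category (set_cat U)"
  by unfold_locales
    (auto simp: set_cat_def Hom_def compose_def fun_eq_iff PiE_iff extensional_def restrict_def)

lemma functor_hom_functor:
  assumes "category C" "locally_small U C" "a \<in> Obj C"
  shows "is_functor C (set_cat U) (hom_functor U C a)"
proof -
  interpret category C by fact
  have sm: "|Inl ` Hom C a x| <o U" if "x \<in> Obj C" for x
    using assms(2,3) that card_of_image ordLeq_ordLess_trans unfolding locally_small_def by blast
  have 1: "FA (hom_functor U C a) f \<in> Hom (set_cat U) (FO (hom_functor U C a) x) (FO (hom_functor U C a) y)"
    if "f \<in> Hom C x y" for f x y
  proof -
    have "x \<in> Obj C" "y \<in> Obj C" "Dom C f = x" "Cod C f = y"
      using that Dom_Obj Cod_Obj by (auto simp: Hom_def)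
    moreover have "Comp C f g \<in> Hom C a y" if "g \<in> Hom C a x" for g
      using that \<open>f \<in> Hom C x y\<close> Comp_Hom by blast
    ultimately show ?thesis
      using sm by (auto simp: hom_functor_def set_cat_def Hom_def[of "cat.make _ _ _ _ _ _", unfolded cat.make_def])
  qed
  have 2: "FA (hom_functor U C a) (Id C x) = Id (set_cat U) (FO (hom_functor U C a) x)"
    if "x \<in> Obj C" for x
  proof -
    have "Dom C (Id C x) = x" "Cod C (Id C x) = x"
      using Id_Hom[OF that] by (auto simp: Hom_def)
    then show ?thesis
      using Id_Comp by (auto simp: hom_functor_def set_cat_def fun_eq_iff restrict_def)
  qed
  have 3: "FA (hom_functor U C a) (Comp C g f) =
      Comp (set_cat U) (FA (hom_functor U C a) g) (FA (hom_functor U C a) f)"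
    if f: "f \<in> Hom C x y" and g: "g \<in> Hom C y z" for f g x y z
  proof -
    have e: "Dom C f = x" "Cod C f = y" "Dom C g = y" "Cod C g = z"
      "Dom C (Comp C g f) = x" "Cod C (Comp C g f) = z"
      using f g Comp_Hom[OF f g] by (auto simp: Hom_def)
    have "Comp C (Comp C g f) k = Comp C g (Comp C f k)" "Comp C f k \<in> Hom C a y"
      if "k \<in> Hom C a x" for k
      using Comp_assoc[OF that f g] Comp_Hom[OF that f] by auto
    then show ?thesis
      by (auto simp: hom_functor_def set_cat_def fun_eq_iff restrict_def compose_def e)
  qed
  have 4: "FO (hom_functor U C a) x \<in> Obj (set_cat U)" if "x \<in> Obj C" for x
    using sm[OF that] by (simp add: hom_functor_def set_cat_def)
  show ?thesis
    unfolding is_functor_def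
    using assms(1) category_set_cat 1 2 3 4 by blast
qed

lemma Hom_Alg:
  "Hom (Alg C F) (X, \<xi>) (Y, \<theta>) = {((X, \<xi>), g, (Y, \<theta>)) | g.
    X \<in> Obj C \<and> \<xi> \<in> Hom C (FO F X) X \<and> Y \<in> Obj C \<and> \<theta> \<in> Hom C (FO F Y) Y \<and>
    g \<in> Hom C X Y \<and> Comp C g \<xi> = Comp C \<theta> (FA F g)}"
  by (auto simp: Alg_def Hom_def)

lemma category_Alg:
  assumes "is_functor C C F"
  shows "category (Alg C F)"
proof -
  interpret category C using assms by (simp add: is_functor_def)
  have F: "\<And>x y f. f \<in> Hom C x y \<Longrightarrow> FA F f \<in> Hom C (FO F x) (FO F y)"
    "\<And>x. x \<in> Obj C \<Longrightarrow> FA F (Id C x) = Id C (FO F x)"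
    "\<And>x y z f g. f \<in> Hom C x y \<Longrightarrow> g \<in> Hom C y z \<Longrightarrow> FA F (Comp C g f) = Comp C (FA F g) (FA F f)"
    using assms by (auto simp: is_functor_def)
  note H = Hom_Alg
  have sq: "Comp C (Comp C h g) \<xi> = Comp C \<zeta> (FA F (Comp C h g))"
    if "\<xi> \<in> Hom C (FO F X) X" "\<theta> \<in> Hom C (FO F Y) Y" "\<zeta> \<in> Hom C (FO F Z) Z"
      "g \<in> Hom C X Y" "h \<in> Hom C Y Z"
      "Comp C g \<xi> = Comp C \<theta> (FA F g)" "Comp C h \<theta> = Comp C \<zeta> (FA F h)"
    for X Y Z \<xi> \<theta> \<zeta> g h
  proof -
    have "Comp C (Comp C h g) \<xi> = Comp C h (Comp C \<theta> (FA F g))"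
      using Comp_assoc[OF that(1,4,5)] that(6) by simp
    also have "\<dots> = Comp C (Comp C \<zeta> (FA F h)) (FA F g)"
      using Comp_assoc[OF F(1)[OF that(4)] that(2,5)] that(7) by simp
    also have "\<dots> = Comp C \<zeta> (FA F (Comp C h g))"
      using Comp_assoc[OF F(1)[OF that(4)] F(1)[OF that(5)] that(3)] F(3)[OF that(4,5)] by simp
    finally show ?thesis .
  qed
  show ?thesis
  proof
    fix x assume "x \<in> Obj (Alg C F)"
    then show "Id (Alg C F) x \<in> Hom (Alg C F) x x"
      using Id_Hom Id_Comp Comp_Id F(2)
      by (cases x) (auto simp: H, auto simp: Alg_def)
  next
    fix f x y g z
    assume "f \<in> Hom (Alg C F) x y" "g \<in> Hom (Alg C F) y z"
    then show "Comp (Alg C F) g f \<in> Hom (Alg C F) x z"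
      using Comp_Hom sq
      by (cases x; cases y; cases z) (auto simp: H, auto simp: Alg_def)
  next
    fix f w x g y h z
    assume "f \<in> Hom (Alg C F) w x" "g \<in> Hom (Alg C F) x y" "h \<in> Hom (Alg C F) y z"
    then show "Comp (Alg C F) h (Comp (Alg C F) g f) = Comp (Alg C F) (Comp (Alg C F) h g) f"
      using Comp_assoc
      by (cases w; cases x; cases y; cases z) (auto simp: H, auto simp: Alg_def)
  next
    fix f x y assume "f \<in> Hom (Alg C F) x y"
    then show "Comp (Alg C F) f (Id (Alg C F) x) = f" "Comp (Alg C F) (Id (Alg C F) y) f = f"
      using Comp_Id Id_Comp
      by (cases x; cases y; auto simp: H, auto simp: Alg_def)+
  qed (auto simp: Alg_def)
qed

lemma functor_reindex:
  assumes "nat_trans C C F G \<alpha>"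
  shows "is_functor (Alg C G) (Alg C F) (reindex C \<alpha>)"
proof -
  have FG: "is_functor C C F" "is_functor C C G" using assms by (auto simp: nat_trans_def)
  interpret category C using FG(1) by (simp add: is_functor_def)
  have A: "\<And>x. x \<in> Obj C \<Longrightarrow> \<alpha> x \<in> Hom C (FO F x) (FO G x)"
    "\<And>x y f. f \<in> Hom C x y \<Longrightarrow> Comp C (\<alpha> y) (FA F f) = Comp C (FA G f) (\<alpha> x)"
    using assms by (auto simp: nat_trans_def)
  have F1: "\<And>x y f. f \<in> Hom C x y \<Longrightarrow> FA F f \<in> Hom C (FO F x) (FO F y)"
    "\<And>x y f. f \<in> Hom C x y \<Longrightarrow> FA G f \<in> Hom C (FO G x) (FO G y)"
    using FG by (auto simp: is_functor_def)
  have ob: "Comp C \<xi> (\<alpha> X) \<in> Hom C (FO F X) X" if "X \<in> Obj C" "\<xi> \<in> Hom C (FO G X) X" for X \<xi>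
    using Comp_Hom[OF A(1)[OF that(1)] that(2)] .
  have sq: "Comp C g (Comp C \<xi> (\<alpha> X)) = Comp C (Comp C \<theta> (\<alpha> Y)) (FA F g)"
    if "X \<in> Obj C" "\<xi> \<in> Hom C (FO G X) X" "Y \<in> Obj C" "\<theta> \<in> Hom C (FO G Y) Y" "g \<in> Hom C X Y"
      "Comp C g \<xi> = Comp C \<theta> (FA G g)" for X \<xi> Y \<theta> g
  proof -
    have "Comp C g (Comp C \<xi> (\<alpha> X)) = Comp C (Comp C \<theta> (FA G g)) (\<alpha> X)"
      using Comp_assoc[OF A(1)[OF that(1)] that(2,5)] that(6) by simp
    also have "\<dots> = Comp C \<theta> (Comp C (\<alpha> Y) (FA F g))"
      using Comp_assoc[OF A(1)[OF that(1)] F1(2)[OF that(5)] that(4)] A(2)[OF that(5)] by simp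
    also have "\<dots> = Comp C (Comp C \<theta> (\<alpha> Y)) (FA F g)"
      using Comp_assoc[OF F1(1)[OF that(5)] A(1)[OF that(3)] that(4)] .
    finally show ?thesis .
  qed
  have arr: "FA (reindex C \<alpha>) f \<in> Hom (Alg C F) (FO (reindex C \<alpha>) x) (FO (reindex C \<alpha>) y)"
    if fh: "f \<in> Hom (Alg C G) x y" for f x y
  proof -
    obtain X \<xi> Y \<theta> where xy: "x = (X, \<xi>)" "y = (Y, \<theta>)" by (cases x; cases y)
    then obtain g where "f = ((X, \<xi>), g, (Y, \<theta>))"
      "X \<in> Obj C" "\<xi> \<in> Hom C (FO G X) X" "Y \<in> Obj C" "\<theta> \<in> Hom C (FO G Y) Y"
      "g \<in> Hom C X Y" "Comp C g \<xi> = Comp C \<theta> (FA G g)"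
      using fh by (auto simp: Hom_Alg)
    then show ?thesis
      using xy ob sq by (simp add: Hom_Alg reindex_def reindex_obj_def)
  qed
  have obj: "FO (reindex C \<alpha>) x \<in> Obj (Alg C F)" if "x \<in> Obj (Alg C G)" for x
    using that ob by (auto simp: Alg_def reindex_def reindex_obj_def)
  have id: "FA (reindex C \<alpha>) (Id (Alg C G) x) = Id (Alg C F) (FO (reindex C \<alpha>) x)" for x
    by (simp add: Alg_def reindex_def reindex_obj_def split: prod.split)
  have comp: "FA (reindex C \<alpha>) (Comp (Alg C G) g f) =
      Comp (Alg C F) (FA (reindex C \<alpha>) g) (FA (reindex C \<alpha>) f)" for f g
    by (simp add: Alg_def reindex_def split: prod.split)
  show ?thesis
    unfolding is_functor_def
    using category_Alg[OF FG(1)] category_Alg[OF FG(2)] obj arr id comp by blast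
qed

end

theory Submission
  imports Defs
begin

text \<open>
  An \<open>F\<close>-algebra \<open>\<xi>: F X \<rightarrow> X\<close> and \<open>\<alpha>\<close> form a span from \<open>F X\<close> to \<open>X\<close> and to \<open>G X\<close>. A morphism
  from \<open>(X, \<xi>)\<close> to the reindexing of a \<open>G\<close>-algebra \<open>(Z, \<theta>)\<close> is an arrow \<open>g: X \<rightarrow> Z\<close> with
  \<open>g \<circ> \<xi> = \<theta> \<circ> \<alpha>\<^sub>Z \<circ> F g\<close>, and by naturality the right side is \<open>\<theta> \<circ> G g \<circ> \<alpha>\<^sub>X\<close>. So \<open>F\<close> has
  disappeared: a left adjoint is obtained from a solution of the following problem. Given any span
  \<open>\<xi>: A \<rightarrow> X\<close>, \<open>a: A \<rightarrow> G X\<close>, thought of as a partially defined \<open>G\<close>-algebra structure on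
  \<open>X\<close>, find the universal total algebra \<open>\<zeta>: G Y \<rightarrow> Y\<close> with an arrow \<open>h: X \<rightarrow> Y\<close> such that
  \<open>h \<circ> \<xi> = \<zeta> \<circ> G h \<circ> a\<close>.

  The solution (\<open>ex_universal_algebra\<close>) is the free-algebra chain \<open>Y\<^sub>0 \<rightarrow> Y\<^sub>1 \<rightarrow> \<dots>\<close>, indexed by the
  ordinals below \<open>\<kappa>\<close>. Here \<open>Y\<^sub>0 = X\<close>, the next stage \<open>Y\<^sub>1\<close> is the pushout of the span, and in
  general \<open>Y\<^sub>i\<close> is the colimit of \<open>X\<close> and all \<open>G Y\<^sub>j\<close> with \<open>j < i\<close>, glued along \<open>A\<close>. This single
  description covers zero, successors and limits, and it makes the chain definable by well-founded
  recursion on objects and cocones alone (\<open>ex_universal\<close>, \<open>ex_chain\<close>): the transition arrow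
  \<open>Y\<^sub>j \<rightarrow> Y\<^sub>i\<close> is the unique one that the universal property of \<open>Y\<^sub>j\<close> provides, so that functoriality
  of the chain needs no separate recursion.

  Let \<open>Y\<close> be the colimit of the chain. As \<open>\<kappa>\<close> is regular, its ordinals form a \<open>\<kappa>\<close>-filtered
  preorder; hence \<open>G Y\<close> is the colimit of the \<open>G Y\<^sub>i\<close>, and the legs \<open>G Y\<^sub>i \<rightarrow> Y\<^sub>k \<rightarrow> Y\<close> for \<open>i < k\<close>
  assemble to \<open>\<zeta>: G Y \<rightarrow> Y\<close> (\<open>colimit_algebra\<close>). An arrow \<open>g\<close> into an algebra \<open>(Z, \<theta>)\<close> extends
  uniquely along the chain, by recursion, to arrows \<open>d\<^sub>i: Y\<^sub>i \<rightarrow> Z\<close> that restrict to \<open>\<theta> \<circ> G d\<^sub>j\<close>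
  on \<open>G Y\<^sub>j\<close>; the induced arrow \<open>Y \<rightarrow> Z\<close> is the required algebra morphism
  (\<open>colimit_algebra_universal\<close>).
\<close>

section \<open>Adjoints from universal arrows\<close>

lemma left_adjoint_from_universal_arrows:
  assumes R: "is_functor D C R"
    and univ: "\<And>x. x \<in> Obj C \<Longrightarrow> \<exists>l e. l \<in> Obj D \<and> e \<in> Hom C x (FO R l) \<and>
      (\<forall>y\<in>Obj D. \<forall>f\<in>Hom C x (FO R y). \<exists>!g. g \<in> Hom D l y \<and> Comp C (FA R g) e = f)"
  shows "has_left_adjoint D C R"
proof -
  interpret C: category C using R by (simp add: is_functor_def)
  interpret D: category D using R by (simp add: is_functor_def)
  have RO: "FO R y \<in> Obj C" if "y \<in> Obj D" for y
    using R that by (simp add: is_functor_def)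
  have RA: "FA R g \<in> Hom C (FO R y) (FO R z)" if "g \<in> Hom D y z" for g y z
    using R that by (simp add: is_functor_def)
  have RI: "FA R (Id D y) = Id C (FO R y)" if "y \<in> Obj D" for y
    using R that by (simp add: is_functor_def)
  have RC: "FA R (Comp D h g) = Comp C (FA R h) (FA R g)"
    if "g \<in> Hom D x y" "h \<in> Hom D y z" for g h x y z
    using R that unfolding is_functor_def by blast
  have DomCod: "Dom C f = x" "Cod C f = y" "x \<in> Obj C" "y \<in> Obj C" if "f \<in> Hom C x y" for f x y
    using that C.Dom_Obj C.Cod_Obj by (auto simp: Hom_def)
  have DObj: "x \<in> Obj D" "y \<in> Obj D" if "f \<in> Hom D x y" for f x y
    using that D.Dom_Obj D.Cod_Obj by (auto simp: Hom_def)
  obtain L e where L: "\<And>x. x \<in> Obj C \<Longrightarrow> L x \<in> Obj D"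
    and e: "\<And>x. x \<in> Obj C \<Longrightarrow> e x \<in> Hom C x (FO R (L x))"
    and ex1: "\<And>x y f. x \<in> Obj C \<Longrightarrow> y \<in> Obj D \<Longrightarrow> f \<in> Hom C x (FO R y) \<Longrightarrow>
      \<exists>!g. g \<in> Hom D (L x) y \<and> Comp C (FA R g) (e x) = f"
    using univ by metis
  \<comment> \<open>\<open>tr\<close> is the transpose across the hom-bijection; the action of the left adjoint on arrows and
      the counit are both transposes.\<close>
  define tr where "tr x y f = (THE g. g \<in> Hom D (L x) y \<and> Comp C (FA R g) (e x) = f)" for x y f
  have tr: "tr x y f \<in> Hom D (L x) y" "Comp C (FA R (tr x y f)) (e x) = f"
    if "x \<in> Obj C" "y \<in> Obj D" "f \<in> Hom C x (FO R y)" for x y f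
    using theI'[OF ex1[OF that]] unfolding tr_def by auto
  have eq: "g = h"
    if "x \<in> Obj C" "g \<in> Hom D (L x) y" "h \<in> Hom D (L x) y"
      "Comp C (FA R g) (e x) = Comp C (FA R h) (e x)" for x y g h
  proof -
    have "Comp C (FA R h) (e x) \<in> Hom C x (FO R y)"
      using C.Comp_Hom e RA that by blast
    from ex1[OF that(1) DObj(2)[OF that(2)] this] show ?thesis using that by blast
  qed
  define LA where "LA f = tr (Dom C f) (L (Cod C f)) (Comp C (e (Cod C f)) f)" for f
  have LA: "LA f \<in> Hom D (L x) (L y)" "Comp C (FA R (LA f)) (e x) = Comp C (e y) f"
    if f: "f \<in> Hom C x y" for f x y
    using tr[OF DomCod(3)[OF f] L[OF DomCod(4)[OF f]] C.Comp_Hom[OF f e[OF DomCod(4)[OF f]]]]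
    by (simp_all add: LA_def DomCod[OF f])
  define L' where "L' = \<lparr>FO = L, FA = LA\<rparr>"
  define ep where "ep y = tr (FO R y) y (Id C (FO R y))" for y
  have ep: "ep y \<in> Hom D (L (FO R y)) y" "Comp C (FA R (ep y)) (e (FO R y)) = Id C (FO R y)"
    if "y \<in> Obj D" for y
    using tr[OF RO[OF that] that C.Id_Hom[OF RO[OF that]]] by (simp_all add: ep_def)
  have Lid: "LA (Id C x) = Id D (L x)" if x: "x \<in> Obj C" for x
    using eq[OF x LA(1)[OF C.Id_Hom[OF x]] D.Id_Hom[OF L[OF x]]]
      LA(2)[OF C.Id_Hom[OF x]] C.Comp_Id[OF e[OF x]] C.Id_Comp[OF e[OF x]] RI[OF L[OF x]] by simp
  have Lcomp: "LA (Comp C g f) = Comp D (LA g) (LA f)"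
    if f: "f \<in> Hom C x y" and g: "g \<in> Hom C y z" for f g x y z
  proof (rule eq)
    note o = DomCod(3)[OF f] DomCod(4)[OF f] DomCod(4)[OF g]
    show "x \<in> Obj C" by (fact o)
    show "LA (Comp C g f) \<in> Hom D (L x) (L z)" using LA(1)[OF C.Comp_Hom[OF f g]] .
    show "Comp D (LA g) (LA f) \<in> Hom D (L x) (L z)"
      using D.Comp_Hom[OF LA(1)[OF f] LA(1)[OF g]] .
    have "Comp C (FA R (Comp D (LA g) (LA f))) (e x)
        = Comp C (FA R (LA g)) (Comp C (FA R (LA f)) (e x))"
      using RC[OF LA(1)[OF f] LA(1)[OF g]]
        C.Comp_assoc[OF e[OF o(1)] RA[OF LA(1)[OF f]] RA[OF LA(1)[OF g]]] by simp
    also have "\<dots> = Comp C (Comp C (FA R (LA g)) (e y)) f"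
      using LA(2)[OF f] C.Comp_assoc[OF f e[OF o(2)] RA[OF LA(1)[OF g]]] by simp
    also have "\<dots> = Comp C (e z) (Comp C g f)"
      using LA(2)[OF g] C.Comp_assoc[OF f g e[OF o(3)]] by simp
    finally show "Comp C (FA R (LA (Comp C g f))) (e x)
        = Comp C (FA R (Comp D (LA g) (LA f))) (e x)"
      using LA(2)[OF C.Comp_Hom[OF f g]] by simp
  qed
  have Lf: "is_functor C D L'"
    unfolding is_functor_def L'_def
    using C.category_axioms D.category_axioms L LA(1) Lid Lcomp by simp
  have RL: "is_functor C C (comp_functor R L')"
    unfolding is_functor_def comp_functor_def L'_def
    using C.category_axioms L LA(1) Lid RO RA RI by (auto simp: Lcomp intro!: RC LA(1))
  have LR: "is_functor D D (comp_functor L' R)"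
    unfolding is_functor_def comp_functor_def L'_def
    using D.category_axioms L LA(1) Lid RO RA RI by (auto simp: RC intro!: Lcomp RA)
  have idf: "is_functor E E id_functor" if "category E" for E :: "('x, 'y) cat"
    using that by (simp add: is_functor_def id_functor_def)
  have eta: "nat_trans C C id_functor (comp_functor R L') e"
    unfolding nat_trans_def using idf[OF C.category_axioms] RL e LA(2)
    by (simp add: id_functor_def comp_functor_def L'_def)
  have epn: "Comp D (ep z) (LA (FA R g)) = Comp D g (ep y)" if g: "g \<in> Hom D y z" for g y z
  proof (rule eq)
    note o = DObj[OF g]
    note Rg = RA[OF g]
    note LR = LA[OF Rg]
    note e1 = e[OF RO[OF o(1)]] and e2 = e[OF RO[OF o(2)]]
    show "FO R y \<in> Obj C" using RO o by simp
    show "Comp D (ep z) (LA (FA R g)) \<in> Hom D (L (FO R y)) z"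
      using D.Comp_Hom[OF LR(1) ep(1)[OF o(2)]] .
    show "Comp D g (ep y) \<in> Hom D (L (FO R y)) z"
      using D.Comp_Hom[OF ep(1)[OF o(1)] g] .
    have "Comp C (FA R (Comp D (ep z) (LA (FA R g)))) (e (FO R y))
        = Comp C (FA R (ep z)) (Comp C (e (FO R z)) (FA R g))"
      using RC[OF LR(1) ep(1)[OF o(2)]] LR(2)
        C.Comp_assoc[OF e1 RA[OF LR(1)] RA[OF ep(1)[OF o(2)]]] by simp
    also have "\<dots> = FA R g"
      using C.Comp_assoc[OF Rg e2 RA[OF ep(1)[OF o(2)]]] ep(2)[OF o(2)] C.Id_Comp[OF Rg] by simp
    also have "\<dots> = Comp C (FA R (Comp D g (ep y))) (e (FO R y))"
      using RC[OF ep(1)[OF o(1)] g] C.Comp_assoc[OF e1 RA[OF ep(1)[OF o(1)]] Rg]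
        ep(2)[OF o(1)] C.Comp_Id[OF Rg] by simp
    finally show "Comp C (FA R (Comp D (ep z) (LA (FA R g)))) (e (FO R y))
        = Comp C (FA R (Comp D g (ep y))) (e (FO R y))" .
  qed
  have eps: "nat_trans D D (comp_functor L' R) id_functor ep"
    unfolding nat_trans_def using idf[OF D.category_axioms] LR ep(1) epn
    by (simp add: id_functor_def comp_functor_def L'_def)
  have tri: "Comp D (ep (L x)) (LA (e x)) = Id D (L x)" if x: "x \<in> Obj C" for x
  proof (rule eq)
    note lx = L[OF x] and ex = e[OF x]
    note Le = LA[OF ex]
    note el = ep[OF lx]
    show "x \<in> Obj C" by fact
    show "Comp D (ep (L x)) (LA (e x)) \<in> Hom D (L x) (L x)"
      using D.Comp_Hom[OF Le(1) el(1)] .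
    show "Id D (L x) \<in> Hom D (L x) (L x)" using D.Id_Hom[OF lx] .
    have "Comp C (FA R (Comp D (ep (L x)) (LA (e x)))) (e x)
        = Comp C (FA R (ep (L x))) (Comp C (e (FO R (L x))) (e x))"
      using RC[OF Le(1) el(1)] C.Comp_assoc[OF ex RA[OF Le(1)] RA[OF el(1)]] Le(2) by simp
    also have "\<dots> = Comp C (Id C (FO R (L x))) (e x)"
      using C.Comp_assoc[OF ex e[OF RO[OF lx]] RA[OF el(1)]] el(2) by simp
    finally show "Comp C (FA R (Comp D (ep (L x)) (LA (e x)))) (e x)
        = Comp C (FA R (Id D (L x))) (e x)"
      using RI[OF lx] by simp
  qed
  have "adjunction C D L' R e ep"
    unfolding adjunction_def using Lf R eta eps tri ep(2) by (simp add: L'_def)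
  then show ?thesis unfolding has_left_adjoint_def by blast
qed

section \<open>Colimits of preorder-shaped diagrams\<close>

text \<open>A diagram on a preorder is given by objects \<open>D p\<close> and arrows \<open>T p q\<close>, over an
  arbitrary index type. This avoids composing through codes of arrows in every
  argument about the chain; the translation to small categories is done once, below.\<close>

definition preorder_diagram ::
  "('o, 'a) cat \<Rightarrow> 'p rel \<Rightarrow> ('p \<Rightarrow> 'o) \<Rightarrow> ('p \<Rightarrow> 'p \<Rightarrow> 'a) \<Rightarrow> bool" where
  "preorder_diagram C r D T \<longleftrightarrow> category C \<and> preorder_on (Field r) r \<and>
    (\<forall>p\<in>Field r. D p \<in> Obj C \<and> T p p = Id C (D p)) \<and>
    (\<forall>p q. (p, q) \<in> r \<longrightarrow> T p q \<in> Hom C (D p) (D q)) \<and>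
    (\<forall>p q s. (p, q) \<in> r \<longrightarrow> (q, s) \<in> r \<longrightarrow> Comp C (T q s) (T p q) = T p s)"

definition preorder_cocone ::
  "('o, 'a) cat \<Rightarrow> 'p rel \<Rightarrow> ('p \<Rightarrow> 'o) \<Rightarrow> ('p \<Rightarrow> 'p \<Rightarrow> 'a) \<Rightarrow> 'o \<Rightarrow> ('p \<Rightarrow> 'a) \<Rightarrow> bool" where
  "preorder_cocone C r D T c \<iota> \<longleftrightarrow> c \<in> Obj C \<and> (\<forall>p\<in>Field r. \<iota> p \<in> Hom C (D p) c) \<and>
    (\<forall>p q. (p, q) \<in> r \<longrightarrow> Comp C (\<iota> q) (T p q) = \<iota> p)"

definition preorder_colimit ::
  "('o, 'a) cat \<Rightarrow> 'p rel \<Rightarrow> ('p \<Rightarrow> 'o) \<Rightarrow> ('p \<Rightarrow> 'p \<Rightarrow> 'a) \<Rightarrow> 'o \<Rightarrow> ('p \<Rightarrow> 'a) \<Rightarrow> bool" where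
  "preorder_colimit C r D T c \<iota> \<longleftrightarrow> preorder_cocone C r D T c \<iota> \<and>
    (\<forall>d \<mu>. preorder_cocone C r D T d \<mu> \<longrightarrow>
      (\<exists>!h. h \<in> Hom C c d \<and> (\<forall>p\<in>Field r. Comp C h (\<iota> p) = \<mu> p)))"

lemma preorder_colimit_cong:
  assumes "preorder_colimit C r D T c \<mu>" "\<And>p. p \<in> Field r \<Longrightarrow> \<mu> p = \<nu> p"
  shows "preorder_colimit C r D T c \<nu>"
proof -
  have "\<nu> p = \<mu> p" "\<nu> q = \<mu> q" if "(p, q) \<in> r" for p q
    using assms(2) that by (simp_all add: FieldI1 FieldI2)
  then have "preorder_cocone C r D T c \<nu> \<longleftrightarrow> preorder_cocone C r D T c \<mu>"
    using assms(2) by (simp add: preorder_cocone_def)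
  then show ?thesis using assms by (simp add: preorder_colimit_def)
qed

text \<open>The pairs of \<open>r\<close> are coded by \<open>e\<close> as elements of the type that small categories live on.
  An object is the code of a diagonal pair, so it is its own identity arrow.\<close>

definition preorder_cat :: "('p \<times> 'p \<Rightarrow> 'u) \<Rightarrow> 'p rel \<Rightarrow> ('u, 'u) cat" where
  "preorder_cat e r = \<lparr>
    Obj = (\<lambda>p. e (p, p)) ` Field r,
    Arr = e ` r,
    Dom = (\<lambda>u. let p = fst (inv_into r e u) in e (p, p)),
    Cod = (\<lambda>u. let q = snd (inv_into r e u) in e (q, q)),
    Id = (\<lambda>u. u),
    Comp = (\<lambda>v u. e (fst (inv_into r e u), snd (inv_into r e v)))\<rparr>"

definition preorder_functor ::
  "('p \<times> 'p \<Rightarrow> 'u) \<Rightarrow> 'p rel \<Rightarrow> ('p \<Rightarrow> 'o) \<Rightarrow> ('p \<Rightarrow> 'p \<Rightarrow> 'a) \<Rightarrow> ('u, 'u, 'o, 'a) fctr" where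
  "preorder_functor e r D T = \<lparr>
    FO = (\<lambda>u. D (fst (inv_into r e u))),
    FA = (\<lambda>u. T (fst (inv_into r e u)) (snd (inv_into r e u)))\<rparr>"

lemma refl_trans_of_preorder:
  assumes "preorder_on (Field r) r"
  shows "p \<in> Field r \<Longrightarrow> (p, p) \<in> r" "(p, q) \<in> r \<Longrightarrow> (q, s) \<in> r \<Longrightarrow> (p, s) \<in> r"
  using assms unfolding preorder_on_def refl_on_def trans_def by blast+

lemma Hom_preorder_cat:
  assumes "inj_on e r" "preorder_on (Field r) r" "p \<in> Field r" "q \<in> Field r"
  shows "Hom (preorder_cat e r) (e (p, p)) (e (q, q)) = (if (p, q) \<in> r then {e (p, q)} else {})"
proof -
  note rf = refl_trans_of_preorder(1)[OF assms(2)]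
  have "e (fst z, fst z) = e (p, p) \<longleftrightarrow> fst z = p" "e (snd z, snd z) = e (q, q) \<longleftrightarrow> snd z = q"
    if "z \<in> r" for z
  proof -
    have "fst z \<in> Field r" "snd z \<in> Field r" using that by (cases z; auto intro: FieldI1 FieldI2)+
    then show "e (fst z, fst z) = e (p, p) \<longleftrightarrow> fst z = p" "e (snd z, snd z) = e (q, q) \<longleftrightarrow> snd z = q"
      using inj_onD[OF assms(1)] rf assms(3,4) by blast+
  qed
  then show ?thesis
    using assms(1) unfolding Hom_def preorder_cat_def by (auto simp: Let_def)
qed

lemma Hom_preorder_catE:
  assumes "inj_on e r" "preorder_on (Field r) r" "u \<in> Hom (preorder_cat e r) x y"
  obtains p q where "(p, q) \<in> r" "x = e (p, p)" "y = e (q, q)" "u = e (p, q)"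
proof -
  obtain p q where pq: "(p, q) \<in> r" "u = e (p, q)" "Dom (preorder_cat e r) u = x" "Cod (preorder_cat e r) u = y"
    using assms(3) by (auto simp: Hom_def preorder_cat_def)
  then show ?thesis using that assms(1) by (auto simp: preorder_cat_def)
qed

lemma category_preorder_cat:
  assumes "inj_on e r" "preorder_on (Field r) r"
  shows "category (preorder_cat e r)"
proof
  note rt = refl_trans_of_preorder[OF assms(2)]
  note H = Hom_preorder_cat[OF assms]
  note HE = Hom_preorder_catE[OF assms]
  have dec [simp]: "inv_into r e (e z) = z" if "z \<in> r" for z using assms(1) that by simp
  have fld: "p \<in> Field r" "q \<in> Field r" if "(p, q) \<in> r" for p q
    using that by (auto intro: FieldI1 FieldI2)
  have diag_inj: "p = q" if "e (p, p) = e (q, q)" "p \<in> Field r" "q \<in> Field r" for p q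
    using inj_onD[OF assms(1) that(1)] rt(1) that(2,3) by simp
  have cmp: "Comp (preorder_cat e r) (e (q, s)) (e (p, q)) = e (p, s)"
    if "(p, q) \<in> r" "(q, s) \<in> r" for p q s
    using that by (simp add: preorder_cat_def)
  {
    fix f assume "f \<in> Arr (preorder_cat e r)"
    then show "Dom (preorder_cat e r) f \<in> Obj (preorder_cat e r)"
      "Cod (preorder_cat e r) f \<in> Obj (preorder_cat e r)"
      by (auto simp: preorder_cat_def fld)
  }
  {
    fix x assume "x \<in> Obj (preorder_cat e r)"
    then show "Id (preorder_cat e r) x \<in> Hom (preorder_cat e r) x x"
      using H rt(1) by (auto simp: preorder_cat_def)
  }
  {
    fix f x y g z assume f: "f \<in> Hom (preorder_cat e r) x y" and g: "g \<in> Hom (preorder_cat e r) y z"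
    obtain p q where 1: "(p, q) \<in> r" "x = e (p, p)" "y = e (q, q)" "f = e (p, q)"
      using HE[OF f] .
    obtain q' s where 2: "(q', s) \<in> r" "y = e (q', q')" "z = e (s, s)" "g = e (q', s)"
      using HE[OF g] .
    have "q' = q" using diag_inj[of q' q] 1 2 fld[of p q] fld[of q' s] by simp
    with 1 2 show "Comp (preorder_cat e r) g f \<in> Hom (preorder_cat e r) x z"
      using cmp[of p q s] H[OF fld(1)[of p q] fld(2)[of q s]] rt(2)[of p q s] by simp
  }
  {
    fix f x y assume f: "f \<in> Hom (preorder_cat e r) x y"
    obtain p q where 1: "(p, q) \<in> r" "x = e (p, p)" "y = e (q, q)" "f = e (p, q)"
      using HE[OF f] .
    have "Id (preorder_cat e r) x = e (p, p)" "Id (preorder_cat e r) y = e (q, q)"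
      by (simp_all add: preorder_cat_def 1)
    with 1 show "Comp (preorder_cat e r) f (Id (preorder_cat e r) x) = f"
      "Comp (preorder_cat e r) (Id (preorder_cat e r) y) f = f"
      using cmp rt(1) fld by simp_all
  }
  {
    fix f w x g y h z
    assume f: "f \<in> Hom (preorder_cat e r) w x" and g: "g \<in> Hom (preorder_cat e r) x y"
      and h: "h \<in> Hom (preorder_cat e r) y z"
    obtain p q where 1: "(p, q) \<in> r" "w = e (p, p)" "x = e (q, q)" "f = e (p, q)"
      using HE[OF f] .
    obtain q' s where 2: "(q', s) \<in> r" "x = e (q', q')" "y = e (s, s)" "g = e (q', s)"
      using HE[OF g] .
    obtain s' t where 3: "(s', t) \<in> r" "y = e (s', s')" "z = e (t, t)" "h = e (s', t)"
      using HE[OF h] .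
    have "q' = q" "s' = s"
      using diag_inj[of q' q] diag_inj[of s' s] 1 2 3 fld[of p q] fld[of q' s] fld[of s' t] by simp_all
    with 1 2 3 have
      "Comp (preorder_cat e r) h g = e (q, t)" "Comp (preorder_cat e r) g f = e (p, s)"
      "(q, t) \<in> r" "(p, s) \<in> r"
      using cmp rt(2) by blast+
    with 1 2 3 \<open>q' = q\<close> \<open>s' = s\<close> cmp
    show "Comp (preorder_cat e r) h (Comp (preorder_cat e r) g f) =
      Comp (preorder_cat e r) (Comp (preorder_cat e r) h g) f"
      by simp
  }
qed

lemma functor_preorder_functor:
  assumes "inj_on e r" "preorder_diagram C r D T"
  shows "is_functor (preorder_cat e r) C (preorder_functor e r D T)"
proof -
  have pre: "preorder_on (Field r) r" and d: "category C"
    "\<And>p. p \<in> Field r \<Longrightarrow> D p \<in> Obj C" "\<And>p. p \<in> Field r \<Longrightarrow> T p p = Id C (D p)"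
    "\<And>p q. (p, q) \<in> r \<Longrightarrow> T p q \<in> Hom C (D p) (D q)"
    "\<And>p q s. (p, q) \<in> r \<Longrightarrow> (q, s) \<in> r \<Longrightarrow> Comp C (T q s) (T p q) = T p s"
    using assms(2) by (auto simp: preorder_diagram_def)
  note rt = refl_trans_of_preorder[OF pre]
  have dec: "inv_into r e (e z) = z" if "z \<in> r" for z using assms(1) that by simp
  have fld: "p \<in> Field r" "q \<in> Field r" if "(p, q) \<in> r" for p q
    using that by (auto intro: FieldI1 FieldI2)
  have diag_inj: "p = q" if "e (p, p) = e (q, q)" "p \<in> Field r" "q \<in> Field r" for p q
    using inj_onD[OF assms(1) that(1)] rt(1) that(2,3) by simp
  have F: "FO (preorder_functor e r D T) (e (p, q)) = D p"
    "FA (preorder_functor e r D T) (e (p, q)) = T p q" if "(p, q) \<in> r" for p q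
    using that by (simp_all add: preorder_functor_def dec)
  have cmp: "FA (preorder_functor e r D T) (Comp (preorder_cat e r) g f) =
      Comp C (FA (preorder_functor e r D T) g) (FA (preorder_functor e r D T) f)"
    if f: "f \<in> Hom (preorder_cat e r) x y" and g: "g \<in> Hom (preorder_cat e r) y z" for f g x y z
  proof -
    obtain p q where 1: "(p, q) \<in> r" "x = e (p, p)" "y = e (q, q)" "f = e (p, q)"
      using Hom_preorder_catE[OF assms(1) pre f] .
    obtain q' s where 2: "(q', s) \<in> r" "y = e (q', q')" "z = e (s, s)" "g = e (q', s)"
      using Hom_preorder_catE[OF assms(1) pre g] .
    have q': "q' = q" using diag_inj[of q' q] 1 2 fld[of p q] fld[of q' s] by simp
    have "Comp (preorder_cat e r) g f = e (p, s)"
      using 1 2 q' by (simp add: preorder_cat_def dec)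
    then show ?thesis using 1 2 q' F d(5) rt(2) by metis
  qed
  have arr: "FA (preorder_functor e r D T) f \<in>
      Hom C (FO (preorder_functor e r D T) x) (FO (preorder_functor e r D T) y)"
    if f: "f \<in> Hom (preorder_cat e r) x y" for f x y
    by (rule Hom_preorder_catE[OF assms(1) pre f]) (simp add: F d(4) rt(1) fld)
  have "FO (preorder_functor e r D T) x \<in> Obj C"
    "FA (preorder_functor e r D T) (Id (preorder_cat e r) x) = Id C (FO (preorder_functor e r D T) x)"
    if "x \<in> Obj (preorder_cat e r)" for x
    using that F d(2,3) rt(1) by (auto simp: preorder_cat_def)
  then show ?thesis
    unfolding is_functor_def using category_preorder_cat[OF assms(1) pre] d(1) arr cmp by blast
qed

text \<open>The functor is an arbitrary one that agrees with \<open>D\<close> and \<open>T\<close> on codes, so that the statement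
  applies to \<^const>\<open>preorder_functor\<close> and also to its composite with an accessible functor.\<close>

lemma is_cocone_preorder_functor:
  assumes "inj_on e r" "preorder_on (Field r) r"
    and F: "is_functor (preorder_cat e r) C X"
    and X: "\<And>p. p \<in> Field r \<Longrightarrow> FO X (e (p, p)) = D p"
      "\<And>p q. (p, q) \<in> r \<Longrightarrow> FA X (e (p, q)) = T p q"
  shows "is_cocone (preorder_cat e r) C X c \<iota> \<longleftrightarrow> preorder_cocone C r D T c (\<lambda>p. \<iota> (e (p, p)))"
proof -
  have fld: "p \<in> Field r" "q \<in> Field r" if "(p, q) \<in> r" for p q
    using that by (auto intro: FieldI1 FieldI2)
  have "(\<forall>j\<in>Obj (preorder_cat e r). \<iota> j \<in> Hom C (FO X j) c) \<longleftrightarrow>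
      (\<forall>p\<in>Field r. \<iota> (e (p, p)) \<in> Hom C (D p) c)"
    by (simp add: preorder_cat_def X)
  moreover have "(\<forall>j k. \<forall>u\<in>Hom (preorder_cat e r) j k. Comp C (\<iota> k) (FA X u) = \<iota> j) \<longleftrightarrow>
      (\<forall>p q. (p, q) \<in> r \<longrightarrow> Comp C (\<iota> (e (q, q))) (T p q) = \<iota> (e (p, p)))"
    (is "?l \<longleftrightarrow> ?r")
  proof
    assume l: ?l
    show ?r
    proof (intro allI impI)
      fix p q assume pq: "(p, q) \<in> r"
      then have "e (p, q) \<in> Hom (preorder_cat e r) (e (p, p)) (e (q, q))"
        using Hom_preorder_cat[OF assms(1,2)] fld by simp
      with l show "Comp C (\<iota> (e (q, q))) (T p q) = \<iota> (e (p, p))"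
        using X(2)[OF pq] by metis
    qed
  next
    assume r: ?r
    show ?l
    proof (intro allI ballI)
      fix j k u assume "u \<in> Hom (preorder_cat e r) j k"
      then show "Comp C (\<iota> k) (FA X u) = \<iota> j"
        by (rule Hom_preorder_catE[OF assms(1,2)]) (simp add: X(2) r)
    qed
  qed
  ultimately show ?thesis
    unfolding is_cocone_def preorder_cocone_def using F by simp
qed

text \<open>The two universal properties quantify over differently indexed cocones; a cocone indexed by
  the preorder is transported to codes by decoding.\<close>

lemma is_colimit_preorder_functor:
  assumes "inj_on e r" "preorder_on (Field r) r"
    and F: "is_functor (preorder_cat e r) C X"
    and X: "\<And>p. p \<in> Field r \<Longrightarrow> FO X (e (p, p)) = D p"
      "\<And>p q. (p, q) \<in> r \<Longrightarrow> FA X (e (p, q)) = T p q"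
  shows "is_colimit (preorder_cat e r) C X c \<iota> \<longleftrightarrow> preorder_colimit C r D T c (\<lambda>p. \<iota> (e (p, p)))"
proof -
  have cc: "is_cocone (preorder_cat e r) C X d \<mu> \<longleftrightarrow> preorder_cocone C r D T d (\<lambda>p. \<mu> (e (p, p)))"
    for d \<mu>
    by (rule is_cocone_preorder_functor[OF assms(1-3) X])
  have ob: "(\<forall>j\<in>Obj (preorder_cat e r). P j) \<longleftrightarrow> (\<forall>p\<in>Field r. P (e (p, p)))" for P
    by (simp add: preorder_cat_def)
  have ext: "\<exists>\<nu>. preorder_cocone C r D T d (\<lambda>p. \<nu> (e (p, p))) \<and> (\<forall>p\<in>Field r. \<nu> (e (p, p)) = \<mu> p)"
    if "preorder_cocone C r D T d \<mu>" for d \<mu>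
  proof -
    define \<nu> where "\<nu> u = \<mu> (fst (inv_into r e u))" for u
    have \<nu>: "\<nu> (e (p, p)) = \<mu> p" if "p \<in> Field r" for p
      using assms(1) refl_trans_of_preorder(1)[OF assms(2) that] by (simp add: \<nu>_def)
    have "preorder_cocone C r D T d (\<lambda>p. \<nu> (e (p, p)))"
      using that \<nu> unfolding preorder_cocone_def by (metis FieldI1 FieldI2)
    with \<nu> show ?thesis by blast
  qed
  have *: "\<exists>!h. h \<in> Hom C c d \<and> (\<forall>p\<in>Field r. Comp C h (\<iota> (e (p, p))) = \<mu> p)"
    if all: "\<forall>d \<mu>. preorder_cocone C r D T d (\<lambda>p. \<mu> (e (p, p))) \<longrightarrow>
        (\<exists>!h. h \<in> Hom C c d \<and> (\<forall>p\<in>Field r. Comp C h (\<iota> (e (p, p))) = \<mu> (e (p, p))))"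
      and "preorder_cocone C r D T d \<mu>" for d \<mu>
  proof -
    from ext[OF that(2)] obtain \<nu> where "preorder_cocone C r D T d (\<lambda>p. \<nu> (e (p, p)))"
      and \<nu>: "\<forall>p\<in>Field r. \<nu> (e (p, p)) = \<mu> p" by blast
    with all have "\<exists>!h. h \<in> Hom C c d \<and> (\<forall>p\<in>Field r. Comp C h (\<iota> (e (p, p))) = \<nu> (e (p, p)))"
      by blast
    then show ?thesis using \<nu> by simp
  qed
  then show ?thesis
    unfolding is_colimit_def preorder_colimit_def cc ob
    by (intro conj_cong refl iffI) (use * in simp_all)
qed

text \<open>A small set of pairs has a code in the universe type because \<open>U\<close> is at most the cardinality of
  that type, and squaring does not lead out of the sets below an infinite cardinal.\<close>

lemma small_relation:
  fixes U :: "'u rel" and r :: "'p rel"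
  assumes "Card_order U" "infinite (Field U)" "|Field r| <o U"
  shows "|r| <o U" "\<exists>e :: 'p \<times> 'p \<Rightarrow> 'u. inj_on e r"
proof -
  have "|Field r \<times> Field r| <o U"
  proof (cases "finite (Field r)")
    case True
    then show ?thesis
      using finite_ordLess_infinite[of "|Field r \<times> Field r|" U, OF card_of_Well_order] assms(1,2)
      by (simp add: Field_card_of card_order_on_well_order_on)
  next
    case False
    then have "|Field r \<times> Field r| =o |Field r|"
      using card_of_Times_same_infinite by blast
    then show ?thesis using assms(3) ordIso_ordLess_trans by blast
  qed
  moreover have "|r| \<le>o |Field r \<times> Field r|"
    by (rule card_of_mono1) (auto intro: FieldI1 FieldI2)
  ultimately show 1: "|r| <o U" using ordLeq_ordLess_trans by blast
  have "U \<le>o |UNIV :: 'u set|"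
    using card_of_Field_ordIso[OF assms(1)] card_of_mono1[of "Field U" UNIV]
      ordIso_ordLeq_trans ordIso_symmetric by blast
  with 1 have "|r| \<le>o |UNIV :: 'u set|"
    using ordLess_ordLeq_trans ordLess_imp_ordLeq by blast
  then show "\<exists>e :: 'p \<times> 'p \<Rightarrow> 'u. inj_on e r"
    using card_of_ordLeq[of r "UNIV :: 'u set"] by auto
qed

lemma ex_preorder_colimit:
  assumes "Card_order U" "infinite (Field U)" "cocomplete U C"
    and d: "preorder_diagram C r D T" and "|Field r| <o U"
  shows "\<exists>c \<iota>. preorder_colimit C r D T c \<iota>"
proof -
  obtain e :: "_ \<Rightarrow> 'a" where e: "inj_on e r"
    using small_relation(2)[OF assms(1,2,5)] by blast
  have pre: "preorder_on (Field r) r" using d by (simp add: preorder_diagram_def)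
  let ?X = "preorder_functor e r D T"
  have F: "is_functor (preorder_cat e r) C ?X"
    using functor_preorder_functor[OF e d] .
  have "small_cat U (preorder_cat e r)"
    using category_preorder_cat[OF e pre] ordLeq_ordLess_trans[OF card_of_image small_relation(1)[OF assms(1,2,5)]]
    by (simp add: small_cat_def preorder_cat_def)
  then obtain c \<iota> where "is_colimit (preorder_cat e r) C ?X c \<iota>"
    using assms(3) F unfolding cocomplete_def by blast
  moreover have "FO ?X (e (p, p)) = D p" if "p \<in> Field r" for p
    using e refl_trans_of_preorder(1)[OF pre that] by (simp add: preorder_functor_def)
  moreover have "FA ?X (e (p, q)) = T p q" if "(p, q) \<in> r" for p q
    using e that by (simp add: preorder_functor_def)
  ultimately show ?thesis
    using is_colimit_preorder_functor[OF e pre F] by blast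
qed

text \<open>In a preorder all diagrams commute, so a cocone on a diagram is just an upper bound of its
  objects.\<close>

lemma filtered_preorder_cat:
  fixes e :: "'p \<times> 'p \<Rightarrow> 'u"
  assumes e: "inj_on e r" and pre: "preorder_on (Field r) r"
    and ub: "\<And>K. K \<subseteq> Field r \<Longrightarrow> |K| <o \<kappa> \<Longrightarrow> \<exists>b\<in>Field r. \<forall>p\<in>K. (p, b) \<in> r"
  shows "filtered \<kappa> (preorder_cat e r)"
  unfolding filtered_def
proof (intro conjI allI impI; (elim conjE)?)
  show "category (preorder_cat e r)" using category_preorder_cat[OF e pre] .
  fix I :: "('u, 'u) cat" and D
  assume I: "category I" "|Arr I| <o \<kappa>" and D: "is_functor I (preorder_cat e r) D"
  interpret I: category I by fact
  have "\<exists>p\<in>Field r. FO D i = e (p, p)" if "i \<in> Obj I" for i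
  proof -
    have "FO D i \<in> Obj (preorder_cat e r)" using D that unfolding is_functor_def by blast
    then show ?thesis by (auto simp: preorder_cat_def)
  qed
  then obtain g where g: "\<And>i. i \<in> Obj I \<Longrightarrow> g i \<in> Field r" "\<And>i. i \<in> Obj I \<Longrightarrow> FO D i = e (g i, g i)"
    by metis
  have "Obj I \<subseteq> Dom I ` Arr I"
  proof
    fix i assume "i \<in> Obj I"
    from I.Id_Hom[OF this] show "i \<in> Dom I ` Arr I" by (force simp: Hom_def)
  qed
  then have "|g ` Obj I| \<le>o |Arr I|"
    by (rule ordLeq_transitive[OF card_of_image ordLeq_transitive[OF card_of_mono1 card_of_image]])
  then have "|g ` Obj I| <o \<kappa>" using I(2) by (rule ordLeq_ordLess_trans)
  then obtain b where b: "b \<in> Field r" "\<And>i. i \<in> Obj I \<Longrightarrow> (g i, b) \<in> r"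
    using ub[of "g ` Obj I"] g(1) by auto
  have "is_cocone I (preorder_cat e r) D (e (b, b)) (\<lambda>i. e (g i, b))"
    unfolding is_cocone_def
  proof (intro conjI ballI allI)
    show "is_functor I (preorder_cat e r) D" by fact
    show "e (b, b) \<in> Obj (preorder_cat e r)" using b by (simp add: preorder_cat_def)
    show "e (g i, b) \<in> Hom (preorder_cat e r) (FO D i) (e (b, b))" if "i \<in> Obj I" for i
      using Hom_preorder_cat[OF e pre g(1)[OF that] b(1)] b(2)[OF that] g(2)[OF that] by simp
    fix i j u assume u: "u \<in> Hom I i j"
    then have o: "i \<in> Obj I" "j \<in> Obj I" using I.Dom_Obj I.Cod_Obj by (auto simp: Hom_def)
    have "FA D u \<in> Hom (preorder_cat e r) (FO D i) (FO D j)"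
      using D u unfolding is_functor_def by blast
    then have "FA D u = e (g i, g j)" "(g i, g j) \<in> r"
      using Hom_preorder_cat[OF e pre g(1)[OF o(1)] g(1)[OF o(2)]] g(2) o by (auto split: if_splits)
    then show "Comp (preorder_cat e r) (e (g j, b)) (FA D u) = e (g i, b)"
      using e b(2)[OF o(2)] by (simp add: preorder_cat_def)
  qed
  then show "\<exists>c \<iota>. is_cocone I (preorder_cat e r) D c \<iota>" by blast
qed

lemma accessible_functor_preorder_colimit:
  assumes "Card_order U" "infinite (Field U)"
    and G: "accessible_functor U \<kappa> C C' G"
    and d: "preorder_diagram C r D T" and sm: "|Field r| <o U"
    and ub: "\<And>K. K \<subseteq> Field r \<Longrightarrow> |K| <o \<kappa> \<Longrightarrow> \<exists>b\<in>Field r. \<forall>p\<in>K. (p, b) \<in> r"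
    and col: "preorder_colimit C r D T c \<iota>"
  shows "preorder_colimit C' r (\<lambda>p. FO G (D p)) (\<lambda>p q. FA G (T p q)) (FO G c) (\<lambda>p. FA G (\<iota> p))"
proof -
  obtain e :: "_ \<Rightarrow> 'a" where e: "inj_on e r"
    using small_relation(2)[OF assms(1,2) sm] by blast
  have pre: "preorder_on (Field r) r" using d by (simp add: preorder_diagram_def)
  let ?X = "preorder_functor e r D T"
  let ?J = "preorder_cat e r"
  let ?\<iota> = "\<lambda>u. \<iota> (fst (inv_into r e u))"
  have F: "is_functor ?J C ?X"
    using functor_preorder_functor[OF e d] .
  have FX: "FO ?X (e (p, p)) = D p" "fst (inv_into r e (e (p, p))) = p" if "p \<in> Field r" for p
    using e refl_trans_of_preorder(1)[OF pre that] by (simp_all add: preorder_functor_def)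
  have FXA: "FA ?X (e (p, q)) = T p q" if "(p, q) \<in> r" for p q
    using e that by (simp add: preorder_functor_def)
  have "preorder_colimit C r D T c (\<lambda>p. ?\<iota> (e (p, p)))"
    using col by (rule preorder_colimit_cong) (simp add: FX(2))
  then have "is_colimit ?J C ?X c ?\<iota>"
    using is_colimit_preorder_functor[OF e pre F FX(1) FXA] by blast
  moreover have "small_cat U ?J"
    using category_preorder_cat[OF e pre] ordLeq_ordLess_trans[OF card_of_image small_relation(1)[OF assms(1,2) sm]]
    by (simp add: small_cat_def preorder_cat_def)
  moreover have "filtered \<kappa> ?J" using filtered_preorder_cat[OF e pre ub] .
  ultimately have GX: "is_colimit ?J C' (comp_functor G ?X) (FO G c) (\<lambda>j. FA G (?\<iota> j))"
    using G unfolding accessible_functor_def preserves_filtered_colimits_def by blast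
  then have F': "is_functor ?J C' (comp_functor G ?X)"
    by (simp add: is_colimit_def is_cocone_def)
  have "preorder_colimit C' r (\<lambda>p. FO G (D p)) (\<lambda>p q. FA G (T p q)) (FO G c)
      (\<lambda>p. FA G (?\<iota> (e (p, p))))"
    using is_colimit_preorder_functor[OF e pre F', of "\<lambda>p. FO G (D p)" "\<lambda>p q. FA G (T p q)" "FO G c"
        "\<lambda>j. FA G (?\<iota> j)"] GX FX(1) FXA by (simp add: comp_functor_def)
  then show ?thesis by (rule preorder_colimit_cong) (simp add: FX(2))
qed

lemma preorder_colimit_eqI:
  assumes "category C" "preorder_diagram C r D T" "preorder_colimit C r D T c \<iota>"
    and f: "f \<in> Hom C c d" and g: "g \<in> Hom C c d"
    and eq: "\<And>p. p \<in> Field r \<Longrightarrow> Comp C f (\<iota> p) = Comp C g (\<iota> p)"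
  shows "f = g"
proof -
  interpret category C by fact
  have T: "T p q \<in> Hom C (D p) (D q)" if "(p, q) \<in> r" for p q
    using assms(2) that by (simp add: preorder_diagram_def)
  have \<iota>: "\<And>p. p \<in> Field r \<Longrightarrow> \<iota> p \<in> Hom C (D p) c"
    "\<And>p q. (p, q) \<in> r \<Longrightarrow> Comp C (\<iota> q) (T p q) = \<iota> p"
    using assms(3) by (auto simp: preorder_colimit_def preorder_cocone_def)
  have "d \<in> Obj C" using g Cod_Obj by (auto simp: Hom_def)
  moreover have "Comp C (Comp C g (\<iota> q)) (T p q) = Comp C g (\<iota> p)" if "(p, q) \<in> r" for p q
    using Comp_assoc[OF T[OF that] \<iota>(1) g] \<iota>(2)[OF that] that by (simp add: FieldI2)
  ultimately have "preorder_cocone C r D T d (\<lambda>p. Comp C g (\<iota> p))"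
    using Comp_Hom[OF \<iota>(1) g] by (simp add: preorder_cocone_def)
  then have "\<exists>!h. h \<in> Hom C c d \<and> (\<forall>p\<in>Field r. Comp C h (\<iota> p) = Comp C g (\<iota> p))"
    using assms(3) by (simp add: preorder_colimit_def)
  then show ?thesis using f g eq by blast
qed

section \<open>The chain of a partial algebra\<close>

text \<open>A stage \<open>i\<close> of the chain is an object \<open>Y\<^sub>i\<close> with arrows \<open>X \<rightarrow> Y\<^sub>i\<close> and \<open>G Y\<^sub>j \<rightarrow> Y\<^sub>i\<close> for \<open>j < i\<close>.\<close>

record ('o, 'a, 'k) stage =
  Carrier :: 'o
  Base :: 'a
  Leg :: "'k \<Rightarrow> 'a"

text \<open>The nodes of the diagram whose colimit is a stage: \<open>Apex\<close> carries \<open>A\<close>, \<open>Attach\<close> carries \<open>X\<close>,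
  and \<open>Stage j\<close> carries \<open>G Y\<^sub>j\<close>.\<close>

datatype 'k node = Apex | Attach | Stage 'k

text \<open>The span \<open>(\<xi>, a)\<close> says what the structure map \<open>G X \<rightarrow> X\<close> should be on the part of \<open>G X\<close> that \<open>A\<close>
  reaches.\<close>

locale partial_algebra = category C
  for C :: "('o, 'a) cat" +
  fixes \<kappa> :: "'k rel" and G :: "('o, 'a, 'o, 'a) fctr"
    and A X :: 'o and \<xi> a :: 'a
  assumes well_order: "Well_order \<kappa>"
    and functor_G: "is_functor C C G"
    and \<xi>: "\<xi> \<in> Hom C A X" and a: "a \<in> Hom C A (FO G X)"
begin

abbreviation cmp (infixr "\<cdot>" 70) where "g \<cdot> f \<equiv> Comp C g f"

abbreviation below (infix "\<prec>" 50) where "j \<prec> i \<equiv> (j, i) \<in> \<kappa> - Relation.Id"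

abbreviation upto (infix "\<preceq>" 50) where "j \<preceq> i \<equiv> (j, i) \<in> \<kappa>"

lemma assoc:
  "f \<in> Hom C w x \<Longrightarrow> g \<in> Hom C x y \<Longrightarrow> h \<in> Hom C y z \<Longrightarrow> (h \<cdot> g) \<cdot> f = h \<cdot> g \<cdot> f"
  using Comp_assoc by simp

lemma G_Obj: "x \<in> Obj C \<Longrightarrow> FO G x \<in> Obj C"
  and G_Hom: "f \<in> Hom C x y \<Longrightarrow> FA G f \<in> Hom C (FO G x) (FO G y)"
  and G_Id: "x \<in> Obj C \<Longrightarrow> FA G (Id C x) = Id C (FO G x)"
  and G_Comp: "f \<in> Hom C x y \<Longrightarrow> g \<in> Hom C y z \<Longrightarrow> FA G (g \<cdot> f) = FA G g \<cdot> FA G f"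
  using functor_G unfolding is_functor_def by blast+

lemma Hom_Obj: "f \<in> Hom C x y \<Longrightarrow> x \<in> Obj C" "f \<in> Hom C x y \<Longrightarrow> y \<in> Obj C"
  using Dom_Obj Cod_Obj by (auto simp: Hom_def)

lemma wf_less: "wf (\<kappa> - Relation.Id)"
  using well_order by (simp add: well_order_on_def)

lemma upto_refl: "i \<in> Field \<kappa> \<Longrightarrow> i \<preceq> i"
  and upto_trans: "i \<preceq> j \<Longrightarrow> j \<preceq> k \<Longrightarrow> i \<preceq> k"
  and upto_antisym: "i \<preceq> j \<Longrightarrow> j \<preceq> i \<Longrightarrow> i = j"
  and upto_total: "i \<in> Field \<kappa> \<Longrightarrow> j \<in> Field \<kappa> \<Longrightarrow> i \<preceq> j \<or> j \<preceq> i"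
  and preorder: "preorder_on (Field \<kappa>) \<kappa>"
proof -
  from well_order have r: "refl_on (Field \<kappa>) \<kappa>" and t: "trans \<kappa>" and as: "antisym \<kappa>"
    and to: "total_on (Field \<kappa>) \<kappa>" and p: "preorder_on (Field \<kappa>) \<kappa>"
    by (auto simp: well_order_on_def linear_order_on_def partial_order_on_def preorder_on_def)
  show "i \<in> Field \<kappa> \<Longrightarrow> i \<preceq> i" using r by (rule refl_onD)
  show "i \<preceq> j \<Longrightarrow> j \<preceq> k \<Longrightarrow> i \<preceq> k" using t by (rule transD)
  show "i \<preceq> j \<Longrightarrow> j \<preceq> i \<Longrightarrow> i = j" using as by (rule antisymD)
  show "i \<in> Field \<kappa> \<Longrightarrow> j \<in> Field \<kappa> \<Longrightarrow> i \<preceq> j \<or> j \<preceq> i"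
    using to refl_onD[OF r] unfolding total_on_def by (cases "i = j") auto
  show "preorder_on (Field \<kappa>) \<kappa>" by (fact p)
qed

lemma below_upto_trans: "i \<prec> j \<Longrightarrow> j \<preceq> k \<Longrightarrow> i \<prec> k"
  using upto_trans upto_antisym by blast

lemma upto_below_trans: "i \<preceq> j \<Longrightarrow> j \<prec> k \<Longrightarrow> i \<prec> k"
  using upto_trans upto_antisym by blast

definition mediates :: "('o, 'a, 'k) stage \<Rightarrow> 'k \<Rightarrow> 'o \<Rightarrow> 'a \<Rightarrow> ('k \<Rightarrow> 'a) \<Rightarrow> 'a \<Rightarrow> bool" where
  "mediates S i Z x z t \<longleftrightarrow> t \<in> Hom C (Carrier S) Z \<and> t \<cdot> Base S = x \<and>
    (\<forall>j. j \<prec> i \<longrightarrow> t \<cdot> Leg S j = z j)"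

text \<open>The transition arrow \<open>Y\<^sub>j \<rightarrow> Y\<^sub>k\<close>. It depends on the data of these two stages only, which
  is what lets the recursion defining the chain carry no arrows between stages.\<close>

definition connect :: "('k \<Rightarrow> ('o, 'a, 'k) stage) \<Rightarrow> 'k \<Rightarrow> 'k \<Rightarrow> 'a" where
  "connect s j k = (THE t. mediates (s j) j (Carrier (s k)) (Base (s k)) (Leg (s k)) t)"

text \<open>The cocones with vertex \<open>Z\<close> on the diagram formed by \<open>X\<close> and by \<open>G Y\<^sub>j\<close> for \<open>j < i\<close>, glued along
  \<open>A\<close>; an initial one is a candidate for stage \<open>i\<close>.\<close>

definition compat :: "('k \<Rightarrow> ('o, 'a, 'k) stage) \<Rightarrow> 'k \<Rightarrow> 'o \<Rightarrow> 'a \<Rightarrow> ('k \<Rightarrow> 'a) \<Rightarrow> bool" where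
  "compat s i Z x z \<longleftrightarrow> Z \<in> Obj C \<and> x \<in> Hom C X Z \<and>
    (\<forall>j. j \<prec> i \<longrightarrow> z j \<in> Hom C (FO G (Carrier (s j))) Z \<and>
      z j \<cdot> FA G (Base (s j)) \<cdot> a = x \<cdot> \<xi>) \<and>
    (\<forall>j k. j \<prec> k \<longrightarrow> k \<prec> i \<longrightarrow> z k \<cdot> FA G (connect s j k) = z j)"

definition universal :: "('k \<Rightarrow> ('o, 'a, 'k) stage) \<Rightarrow> 'k \<Rightarrow> ('o, 'a, 'k) stage \<Rightarrow> bool" where
  "universal s i S \<longleftrightarrow> compat s i (Carrier S) (Base S) (Leg S) \<and>
    (\<forall>Z x z. compat s i Z x z \<longrightarrow> (\<exists>!t. mediates S i Z x z t))"

lemma mediates_cong: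
  "(\<And>j. j \<prec> i \<Longrightarrow> z j = z' j) \<Longrightarrow> mediates S i Z x z t = mediates S i Z x z' t"
  by (simp add: mediates_def)

lemma compat_cong:
  assumes "\<And>j. j \<prec> i \<Longrightarrow> s j = s' j"
  shows "compat s i Z x z = compat s' i Z x z"
proof -
  have "connect s j k = connect s' j k" if "j \<prec> k" "k \<prec> i" for j k
    unfolding connect_def assms[OF that(2)] assms[OF below_upto_trans[OF that(1) DiffD1[OF that(2)]]] ..
  then have 1: "(\<forall>j k. j \<prec> k \<longrightarrow> k \<prec> i \<longrightarrow> z k \<cdot> FA G (connect s j k) = z j) \<longleftrightarrow>
      (\<forall>j k. j \<prec> k \<longrightarrow> k \<prec> i \<longrightarrow> z k \<cdot> FA G (connect s' j k) = z j)"
    by (intro all_cong1 imp_cong refl) (simp only:)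
  have 2: "(\<forall>j. j \<prec> i \<longrightarrow> z j \<in> Hom C (FO G (Carrier (s j))) Z \<and>
        z j \<cdot> FA G (Base (s j)) \<cdot> a = x \<cdot> \<xi>) \<longleftrightarrow>
      (\<forall>j. j \<prec> i \<longrightarrow> z j \<in> Hom C (FO G (Carrier (s' j))) Z \<and>
        z j \<cdot> FA G (Base (s' j)) \<cdot> a = x \<cdot> \<xi>)"
    by (intro all_cong1 imp_cong refl) (simp only: assms)
  show ?thesis unfolding compat_def 1 2 ..
qed

lemma universal_cong:
  "(\<And>j. j \<prec> i \<Longrightarrow> s j = s' j) \<Longrightarrow> universal s i S = universal s' i S"
  using compat_cong[of i s s'] by (simp add: universal_def)

lemma compat_mono: "compat s k Z x z \<Longrightarrow> j \<preceq> k \<Longrightarrow> compat s j Z x z"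
  unfolding compat_def using below_upto_trans by blast

lemma universal_compat: "universal s i (s i) \<Longrightarrow> compat s i (Carrier (s i)) (Base (s i)) (Leg (s i))"
  by (simp add: universal_def)

lemma Carrier_Obj: "universal s i (s i) \<Longrightarrow> Carrier (s i) \<in> Obj C"
  and Base_Hom: "universal s i (s i) \<Longrightarrow> Base (s i) \<in> Hom C X (Carrier (s i))"
  and Leg_Hom: "universal s i (s i) \<Longrightarrow> j \<prec> i \<Longrightarrow>
    Leg (s i) j \<in> Hom C (FO G (Carrier (s j))) (Carrier (s i))"
  by (auto simp: universal_def compat_def)

lemma mediates_unique:
  "universal s i (s i) \<Longrightarrow> compat s i Z x z \<Longrightarrow> mediates (s i) i Z x z t \<Longrightarrow>
    mediates (s i) i Z x z t' \<Longrightarrow> t = t'"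
  unfolding universal_def by blast

lemma mediates_connect:
  assumes "universal s j (s j)" "universal s k (s k)" "j \<preceq> k"
  shows "mediates (s j) j (Carrier (s k)) (Base (s k)) (Leg (s k)) (connect s j k)"
proof -
  have "\<exists>!t. mediates (s j) j (Carrier (s k)) (Base (s k)) (Leg (s k)) t"
    using assms(1) compat_mono[OF universal_compat[OF assms(2)] assms(3)]
    unfolding universal_def by blast
  then show ?thesis unfolding connect_def by (rule theI')
qed

lemma connect_Hom:
  "universal s j (s j) \<Longrightarrow> universal s k (s k) \<Longrightarrow> j \<preceq> k \<Longrightarrow>
    connect s j k \<in> Hom C (Carrier (s j)) (Carrier (s k))"
  using mediates_connect[of s j k] by (simp add: mediates_def)

lemma connect_Base:
  "universal s j (s j) \<Longrightarrow> universal s k (s k) \<Longrightarrow> j \<preceq> k \<Longrightarrow>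
    connect s j k \<cdot> Base (s j) = Base (s k)"
  using mediates_connect[of s j k] by (simp add: mediates_def)

lemma connect_Leg:
  "universal s j (s j) \<Longrightarrow> universal s k (s k) \<Longrightarrow> j \<preceq> k \<Longrightarrow> l \<prec> j \<Longrightarrow>
    connect s j k \<cdot> Leg (s j) l = Leg (s k) l"
  using mediates_connect[of s j k] by (simp add: mediates_def)

text \<open>With uniqueness of mediating arrows this turns every equation between arrows out of a stage into
  a statement about one cocone; functoriality of the transition arrows is the first instance.\<close>

lemma mediates_comp_connect:
  assumes j: "universal s j (s j)" and k: "universal s k (s k)" and le: "j \<preceq> k"
    and t: "mediates (s k) k Z x z t"
  shows "mediates (s j) j Z x z (t \<cdot> connect s j k)"
proof -
  have tH: "t \<in> Hom C (Carrier (s k)) Z" using t by (simp add: mediates_def)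
  note tr = connect_Hom[OF j k le]
  have "(t \<cdot> connect s j k) \<cdot> Base (s j) = x"
    using assoc[OF Base_Hom[OF j] tr tH] connect_Base[OF j k le] t by (simp add: mediates_def)
  moreover have "(t \<cdot> connect s j k) \<cdot> Leg (s j) l = z l" if "l \<prec> j" for l
    using assoc[OF Leg_Hom[OF j that] tr tH] connect_Leg[OF j k le that] t below_upto_trans[OF that le]
    by (simp add: mediates_def)
  ultimately show ?thesis using Comp_Hom[OF tr tH] by (simp add: mediates_def)
qed

lemma connect_self:
  assumes "universal s j (s j)" "j \<in> Field \<kappa>"
  shows "connect s j j = Id C (Carrier (s j))"
proof (rule mediates_unique[OF assms(1) universal_compat[OF assms(1)]])
  show "mediates (s j) j (Carrier (s j)) (Base (s j)) (Leg (s j)) (connect s j j)"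
    using mediates_connect[OF assms(1,1) upto_refl[OF assms(2)]] .
  show "mediates (s j) j (Carrier (s j)) (Base (s j)) (Leg (s j)) (Id C (Carrier (s j)))"
    using Id_Hom[OF Carrier_Obj[OF assms(1)]] Id_Comp[OF Base_Hom[OF assms(1)]]
      Id_Comp[OF Leg_Hom[OF assms(1)]] by (simp add: mediates_def)
qed

lemma connect_connect:
  assumes j: "universal s j (s j)" and k: "universal s k (s k)" and l: "universal s l (s l)"
    and jk: "j \<preceq> k" and kl: "k \<preceq> l"
  shows "connect s k l \<cdot> connect s j k = connect s j l"
  using mediates_unique[OF j compat_mono[OF universal_compat[OF l] upto_trans[OF jk kl]]
      mediates_comp_connect[OF j k jk mediates_connect[OF k l kl]]
      mediates_connect[OF j l upto_trans[OF jk kl]]] .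

text \<open>The cocones in \<^const>\<open>compat\<close> are the cocones on a small preorder diagram,
  in which \<open>Apex\<close> lies below everything, the nodes \<open>Stage j\<close> form a chain, and \<open>Attach\<close> is above
  \<open>Apex\<close> only. The component at \<open>Apex\<close> is determined by the one at \<open>Attach\<close>.\<close>

lemma ex_universal:
  assumes U: "Card_order U" "infinite (Field U)" "cocomplete U C" and \<kappa>U: "\<kappa> <o U"
    and s: "\<And>j. j \<prec> i \<Longrightarrow> universal s j (s j)"
  shows "\<exists>S. universal s i S"
proof -
  define N where "N = {Apex, Attach} \<union> Stage ` {j. j \<prec> i}"
  define r where "r = {(m, n). m \<in> N \<and> n \<in> N \<and> (m = n \<or> m = Apex \<or>
    (\<exists>j k. m = Stage j \<and> n = Stage k \<and> j \<preceq> k))}"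
  define D where "D n = (case n of Apex \<Rightarrow> A | Attach \<Rightarrow> X | Stage j \<Rightarrow> FO G (Carrier (s j)))" for n
  define T where "T m n = (case (m, n) of
      (Apex, Attach) \<Rightarrow> \<xi> | (Apex, Stage j) \<Rightarrow> FA G (Base (s j)) \<cdot> a |
      (Stage j, Stage k) \<Rightarrow> FA G (connect s j k) | _ \<Rightarrow> Id C (D m))" for m n
  have Fr: "Field r = N" by (auto simp: r_def Field_def)
  have rE: "P m n" if "(m, n) \<in> r" "P Apex Apex" "P Attach Attach" "P Apex Attach"
    "\<And>j. j \<prec> i \<Longrightarrow> P Apex (Stage j)" "\<And>j k. j \<prec> i \<Longrightarrow> k \<prec> i \<Longrightarrow> j \<preceq> k \<Longrightarrow> P (Stage j) (Stage k)"
    for P m n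
    using that(1) that(2-) upto_refl FieldI1[of _ i \<kappa>] unfolding r_def N_def by auto
  have B: "Base (s j) \<in> Hom C X (Carrier (s j))" if "j \<prec> i" for j
    using Base_Hom[OF s[OF that]] .
  have GBa: "FA G (Base (s j)) \<cdot> a \<in> Hom C A (FO G (Carrier (s j)))" if "j \<prec> i" for j
    using Comp_Hom[OF a G_Hom[OF B[OF that]]] .
  have tr: "connect s j k \<in> Hom C (Carrier (s j)) (Carrier (s k))" if "j \<prec> i" "k \<prec> i" "j \<preceq> k" for j k
    using connect_Hom[OF s[OF that(1)] s[OF that(2)] that(3)] .
  have ob: "A \<in> Obj C" "X \<in> Obj C" "\<And>j. j \<prec> i \<Longrightarrow> FO G (Carrier (s j)) \<in> Obj C"
    using Hom_Obj[OF \<xi>] G_Obj Hom_Obj(2)[OF B] by auto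
  have TId: "T (Stage j) (Stage j) = Id C (FO G (Carrier (s j)))" if "j \<prec> i" for j
    using connect_self[OF s[OF that]] G_Id Hom_Obj(2)[OF B[OF that]] that FieldI1[of j i \<kappa>]
    by (simp add: T_def)
  have TH: "T m n \<in> Hom C (D m) (D n)" if "(m, n) \<in> r" for m n
    by (rule rE[OF that]) (auto simp: T_def D_def Id_Hom ob \<xi> GBa G_Hom tr)
  have TId': "T n n = Id C (D n)" if "n \<in> N" for n
    using that TId by (auto simp: N_def) (auto simp: T_def D_def)
  have DO: "D n \<in> Obj C" if "n \<in> N" for n
    using that ob by (auto simp: N_def D_def)
  have compo: "T n p \<cdot> T m n = T m p" if mn: "(m, n) \<in> r" and np: "(n, p) \<in> r" for m n p
  proof -
    have mp: "m \<in> N" "n \<in> N" "p \<in> N" using mn np by (auto simp: r_def)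
    show ?thesis
    proof (cases "m = n \<or> n = p")
      case True
      then show ?thesis
        using TId' mp Comp_Id[OF TH[OF np]] Id_Comp[OF TH[OF mn]] by auto
    next
      case False
      then obtain j k where n: "n = Stage j" and p: "p = Stage k" and jk: "j \<preceq> k" "j \<prec> i" "k \<prec> i"
        and m: "m = Apex \<or> (\<exists>l. m = Stage l \<and> l \<preceq> j \<and> l \<prec> i)"
        using mn np by (auto simp: r_def N_def)
      from m show ?thesis
      proof
        assume "m = Apex"
        have "FA G (connect s j k) \<cdot> FA G (Base (s j)) \<cdot> a = FA G (Base (s k)) \<cdot> a"
          using assoc[OF a G_Hom[OF B[OF jk(2)]] G_Hom[OF tr[OF jk(2,3,1)]]]
            G_Comp[OF B[OF jk(2)] tr[OF jk(2,3,1)]] connect_Base[OF s[OF jk(2)] s[OF jk(3)] jk(1)]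
          by simp
        with \<open>m = Apex\<close> n p show ?thesis by (simp add: T_def)
      next
        assume "\<exists>l. m = Stage l \<and> l \<preceq> j \<and> l \<prec> i"
        then obtain l where l: "m = Stage l" "l \<preceq> j" "l \<prec> i" by blast
        have "FA G (connect s j k) \<cdot> FA G (connect s l j) = FA G (connect s l k)"
          using G_Comp[OF tr[OF l(3) jk(2) l(2)] tr[OF jk(2,3,1)]]
            connect_connect[OF s[OF l(3)] s[OF jk(2)] s[OF jk(3)] l(2) jk(1)] by simp
        with l(1) n p show ?thesis by (simp add: T_def)
      qed
    qed
  qed
  have "preorder_on N r"
    unfolding preorder_on_def
  proof (intro conjI)
    show "trans r"
    proof (rule transI)
      fix m n p assume "(m, n) \<in> r" "(n, p) \<in> r"
      then show "(m, p) \<in> r" unfolding r_def using upto_trans by blast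
    qed
  qed (auto simp: r_def refl_on_def)
  then have diag: "preorder_diagram C r D T"
    unfolding preorder_diagram_def Fr using category_axioms TH TId' DO compo by blast
  have "|N| <o U"
  proof -
    have "|Field \<kappa>| <o U"
      using card_of_least[OF well_order] \<kappa>U ordLeq_ordLess_trans by blast
    then have "|{j. j \<prec> i}| <o U"
      using card_of_mono1[of "{j. j \<prec> i}" "Field \<kappa>"] ordLeq_ordLess_trans
      by (force intro: FieldI1)
    then have st: "|Stage ` {j. j \<prec> i}| <o U" by (rule ordLeq_ordLess_trans[OF card_of_image])
    have "|{Apex, Attach :: 'k node}| <o U"
      using finite_ordLess_infinite[of "|{Apex, Attach :: 'k node}|" U, OF card_of_Well_order] U(1,2)
      by (simp add: Field_card_of card_order_on_well_order_on)
    then show ?thesis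
      unfolding N_def using st by (rule card_of_Un_ordLess_infinite_Field[OF U(2,1)])
  qed
  then obtain c \<iota> where col: "preorder_colimit C r D T c \<iota>"
    using ex_preorder_colimit[OF U diag] Fr by auto
  have coc: "preorder_cocone C r D T Z \<mu> \<longleftrightarrow>
      compat s i Z (\<mu> Attach) (\<lambda>j. \<mu> (Stage j)) \<and> \<mu> Apex = \<mu> Attach \<cdot> \<xi>" for Z \<mu>
  proof
    assume "preorder_cocone C r D T Z \<mu>"
    then have Z: "Z \<in> Obj C" and \<mu>: "\<And>n. n \<in> N \<Longrightarrow> \<mu> n \<in> Hom C (D n) Z"
      "\<And>m n. (m, n) \<in> r \<Longrightarrow> \<mu> n \<cdot> T m n = \<mu> m"
      by (auto simp: preorder_cocone_def Fr)
    have "\<mu> Attach \<in> Hom C X Z" using \<mu>(1)[of Attach] by (simp add: N_def D_def)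
    moreover have 1: "\<mu> Apex = \<mu> Attach \<cdot> \<xi>"
      using \<mu>(2)[of Apex Attach] by (simp add: r_def N_def T_def)
    moreover have "\<mu> (Stage j) \<in> Hom C (FO G (Carrier (s j))) Z" if "j \<prec> i" for j
      using \<mu>(1)[of "Stage j"] that by (simp add: N_def D_def)
    moreover have "\<mu> (Stage j) \<cdot> FA G (Base (s j)) \<cdot> a = \<mu> Attach \<cdot> \<xi>" if "j \<prec> i" for j
      using \<mu>(2)[of Apex "Stage j"] that 1 by (simp add: r_def N_def T_def)
    moreover have "\<mu> (Stage k) \<cdot> FA G (connect s j k) = \<mu> (Stage j)" if "j \<prec> k" "k \<prec> i" for j k
      using \<mu>(2)[of "Stage j" "Stage k"] that below_upto_trans[of j k i] by (simp add: r_def N_def T_def)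
    ultimately show "compat s i Z (\<mu> Attach) (\<lambda>j. \<mu> (Stage j)) \<and> \<mu> Apex = \<mu> Attach \<cdot> \<xi>"
      using Z by (simp add: compat_def)
  next
    assume *: "compat s i Z (\<mu> Attach) (\<lambda>j. \<mu> (Stage j)) \<and> \<mu> Apex = \<mu> Attach \<cdot> \<xi>"
    then have Z: "Z \<in> Obj C" and ap: "\<mu> Apex = \<mu> Attach \<cdot> \<xi>" and at: "\<mu> Attach \<in> Hom C X Z"
      and st: "\<And>j. j \<prec> i \<Longrightarrow> \<mu> (Stage j) \<in> Hom C (FO G (Carrier (s j))) Z"
        "\<And>j. j \<prec> i \<Longrightarrow> \<mu> (Stage j) \<cdot> FA G (Base (s j)) \<cdot> a = \<mu> Apex"
        "\<And>j k. j \<prec> k \<Longrightarrow> k \<prec> i \<Longrightarrow> \<mu> (Stage k) \<cdot> FA G (connect s j k) = \<mu> (Stage j)"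
      by (auto simp: compat_def)
    have apH: "\<mu> Apex \<in> Hom C A Z" using Comp_Hom[OF \<xi> at] ap by simp
    have H: "\<mu> n \<in> Hom C (D n) Z" if "n \<in> N" for n
      using that apH at st(1) by (auto simp: N_def D_def)
    have "\<mu> n \<cdot> T m n = \<mu> m" if "(m, n) \<in> r" for m n
    proof (rule rE[OF that])
      show "\<mu> Apex \<cdot> T Apex Apex = \<mu> Apex" "\<mu> Attach \<cdot> T Attach Attach = \<mu> Attach"
        using Comp_Id apH at by (auto simp: T_def D_def)
      show "\<mu> Attach \<cdot> T Apex Attach = \<mu> Apex" using ap by (simp add: T_def)
      show "\<mu> (Stage j) \<cdot> T Apex (Stage j) = \<mu> Apex" if "j \<prec> i" for j
        using st(2)[OF that] by (simp add: T_def)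
      show "\<mu> (Stage k) \<cdot> T (Stage j) (Stage k) = \<mu> (Stage j)" if "j \<prec> i" "k \<prec> i" "j \<preceq> k" for j k
      proof (cases "j = k")
        case True
        then show ?thesis using TId[OF that(1)] Comp_Id[OF st(1)[OF that(1)]] by simp
      next
        case False
        then show ?thesis using st(3)[of j k] that by (simp add: T_def)
      qed
    qed
    then show "preorder_cocone C r D T Z \<mu>"
      using Z H by (simp add: preorder_cocone_def Fr)
  qed
  let ?S = "\<lparr>Carrier = c, Base = \<iota> Attach, Leg = \<lambda>j. \<iota> (Stage j)\<rparr>"
  have \<iota>: "compat s i c (\<iota> Attach) (\<lambda>j. \<iota> (Stage j))" "\<iota> Apex = \<iota> Attach \<cdot> \<xi>"
    using col coc by (auto simp: preorder_colimit_def)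
  have "\<exists>!t. mediates ?S i Z x z t" if "compat s i Z x z" for Z x z
  proof -
    define \<mu> where "\<mu> n = (case n of Apex \<Rightarrow> x \<cdot> \<xi> | Attach \<Rightarrow> x | Stage j \<Rightarrow> z j)" for n
    have "preorder_cocone C r D T Z \<mu>" using that by (simp add: coc \<mu>_def)
    then have "\<exists>!t. t \<in> Hom C c Z \<and> (\<forall>n\<in>N. t \<cdot> \<iota> n = \<mu> n)"
      using col by (simp add: preorder_colimit_def Fr)
    moreover have "(\<forall>n\<in>N. t \<cdot> \<iota> n = \<mu> n) \<longleftrightarrow> t \<cdot> \<iota> Attach = x \<and> (\<forall>j. j \<prec> i \<longrightarrow> t \<cdot> \<iota> (Stage j) = z j)"
      if t: "t \<in> Hom C c Z" for t
    proof -
      have "t \<cdot> \<iota> Apex = (t \<cdot> \<iota> Attach) \<cdot> \<xi>"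
        using assoc[OF \<xi> _ t] \<iota> by (simp add: compat_def)
      then show ?thesis by (auto simp: N_def \<mu>_def)
    qed
    ultimately show ?thesis by (simp add: mediates_def cong: conj_cong)
  qed
  then have "universal s i ?S" using \<iota>(1) by (simp add: universal_def)
  then show ?thesis by blast
qed

lemma ex_chain:
  assumes "Card_order U" "infinite (Field U)" "cocomplete U C" "\<kappa> <o U"
  shows "\<exists>s. \<forall>i. universal s i (s i)"
  using wf_less
proof (rule dependent_wf_choice)
  show "universal s i S = universal s' i S" if "\<And>j. j \<prec> i \<Longrightarrow> s j = s' j" for s s' i S
    using universal_cong that .
  show "\<exists>S. universal s i S" if "\<And>j. j \<prec> i \<Longrightarrow> universal s j (s j)" for i s
    using ex_universal[OF assms that] .
qed

end

section \<open>The colimit of the chain\<close>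

context partial_algebra
begin

context
  fixes s :: "'k \<Rightarrow> ('o, 'a, 'k) stage"
  assumes univ: "\<And>i. universal s i (s i)"
begin

lemmas s_Obj = Carrier_Obj[OF univ]
  and s_Base = Base_Hom[OF univ]
  and s_Leg = Leg_Hom[OF univ]
  and s_Hom = connect_Hom[OF univ univ]
  and s_connect_Base = connect_Base[OF univ univ]
  and s_connect_Leg = connect_Leg[OF univ univ]

lemma chain_diagram: "preorder_diagram C \<kappa> (\<lambda>i. Carrier (s i)) (connect s)"
  unfolding preorder_diagram_def
  using category_axioms preorder s_Obj connect_self[OF univ] s_Hom
    connect_connect[OF univ univ univ] by blast

lemma chain_diagram_image:
  "preorder_diagram C \<kappa> (\<lambda>i. FO G (Carrier (s i))) (\<lambda>j k. FA G (connect s j k))"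
  unfolding preorder_diagram_def
proof (intro conjI allI impI ballI)
  show "category C" "preorder_on (Field \<kappa>) \<kappa>" using category_axioms preorder by blast+
  show "FO G (Carrier (s i)) \<in> Obj C" for i using G_Obj[OF s_Obj] .
  show "FA G (connect s i i) = Id C (FO G (Carrier (s i)))" if "i \<in> Field \<kappa>" for i
    using connect_self[OF univ that] G_Id[OF s_Obj] by simp
  show "FA G (connect s j k) \<in> Hom C (FO G (Carrier (s j))) (FO G (Carrier (s k)))" if "j \<preceq> k" for j k
    using G_Hom[OF s_Hom[OF that]] .
  show "FA G (connect s k l) \<cdot> FA G (connect s j k) = FA G (connect s j l)" if "j \<preceq> k" "k \<preceq> l" for j k l
    using G_Comp[OF s_Hom[OF that(1)] s_Hom[OF that(2)]] connect_connect[OF univ univ univ that] by simp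
qed

text \<open>Arrows \<open>d j\<close> defined by recursion along the chain automatically commute with the transition
  arrows: \<open>d k\<close> composed with \<open>Y\<^sub>j \<rightarrow> Y\<^sub>k\<close> solves the recursion at \<open>j\<close>, whose solution is unique. The
  induction supplies the cocone at \<open>j\<close> for which uniqueness is invoked.\<close>

lemma compat_algebra:
  assumes Z: "Z \<in> Obj C" and \<theta>: "\<theta> \<in> Hom C (FO G Z) Z" and g: "g \<in> Hom C X Z"
    and sq: "g \<cdot> \<xi> = \<theta> \<cdot> FA G g \<cdot> a"
    and d: "\<And>j. j \<prec> i \<Longrightarrow> mediates (s j) j Z g (\<lambda>l. \<theta> \<cdot> FA G (d l)) (d j)"
  shows "compat s i Z g (\<lambda>j. \<theta> \<cdot> FA G (d j))"
  using wf_less d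
proof (induction i)
  case (less i)
  have dH: "d j \<in> Hom C (Carrier (s j)) Z" and dB: "d j \<cdot> Base (s j) = g" if "j \<prec> i" for j
    using less.prems[OF that] by (simp_all add: mediates_def)
  have 1: "\<theta> \<cdot> FA G (d j) \<in> Hom C (FO G (Carrier (s j))) Z" if "j \<prec> i" for j
    using Comp_Hom[OF G_Hom[OF dH[OF that]] \<theta>] .
  have 2: "(\<theta> \<cdot> FA G (d j)) \<cdot> FA G (Base (s j)) \<cdot> a = g \<cdot> \<xi>" if "j \<prec> i" for j
  proof -
    note GB = G_Hom[OF s_Base] and Gd = G_Hom[OF dH[OF that]]
    have "(\<theta> \<cdot> FA G (d j)) \<cdot> FA G (Base (s j)) \<cdot> a = \<theta> \<cdot> (FA G (d j) \<cdot> FA G (Base (s j))) \<cdot> a"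
      using assoc[OF Comp_Hom[OF a GB] Gd \<theta>] assoc[OF a GB Gd] by simp
    also have "FA G (d j) \<cdot> FA G (Base (s j)) = FA G g"
      using G_Comp[OF s_Base dH[OF that]] dB[OF that] by simp
    finally show ?thesis using sq by simp
  qed
  have 3: "(\<theta> \<cdot> FA G (d k)) \<cdot> FA G (connect s j k) = \<theta> \<cdot> FA G (d j)" if jk: "j \<prec> k" and ki: "k \<prec> i" for j k
  proof -
    have ji: "j \<prec> i" using below_upto_trans[OF jk] ki by blast
    have jk': "j \<preceq> k" using jk by blast
    have "compat s j Z g (\<lambda>l. \<theta> \<cdot> FA G (d l))"
    proof (rule less.IH[OF ji])
      show "mediates (s l) l Z g (\<lambda>l. \<theta> \<cdot> FA G (d l)) (d l)" if "l \<prec> j" for l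
        using less.prems[of l] below_upto_trans[OF that] ji by blast
    qed
    then have "d k \<cdot> connect s j k = d j"
      using mediates_unique[OF univ _ mediates_comp_connect[OF univ univ jk' less.prems[OF ki]]
          less.prems[OF ji]] by simp
    then show ?thesis
      using assoc[OF G_Hom[OF s_Hom[OF jk']] G_Hom[OF dH[OF ki]] \<theta>]
        G_Comp[OF s_Hom[OF jk'] dH[OF ki]] by simp
  qed
  show ?case unfolding compat_def using Z g 1 2 3 by blast
qed

lemma ex_maps_to_algebra:
  assumes "Z \<in> Obj C" "\<theta> \<in> Hom C (FO G Z) Z" "g \<in> Hom C X Z" "g \<cdot> \<xi> = \<theta> \<cdot> FA G g \<cdot> a"
  shows "\<exists>d. \<forall>i. mediates (s i) i Z g (\<lambda>l. \<theta> \<cdot> FA G (d l)) (d i)"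
  using wf_less
proof (rule dependent_wf_choice)
  show "mediates (s i) i Z g (\<lambda>l. \<theta> \<cdot> FA G (d l)) t = mediates (s i) i Z g (\<lambda>l. \<theta> \<cdot> FA G (d' l)) t"
    if "\<And>j. j \<prec> i \<Longrightarrow> d j = d' j" for d d' i t
    by (rule mediates_cong) (simp only: that)
  show "\<exists>t. mediates (s i) i Z g (\<lambda>l. \<theta> \<cdot> FA G (d l)) t"
    if "\<And>j. j \<prec> i \<Longrightarrow> mediates (s j) j Z g (\<lambda>l. \<theta> \<cdot> FA G (d l)) (d j)" for i d
    using compat_algebra[OF assms that] univ unfolding universal_def by blast
qed

text \<open>The leg of \<open>\<zeta>\<close> at \<open>j\<close> passes through any later stage \<open>k\<close>; such a \<open>k\<close> exists because the chain has
  no last index, and the choice does not matter because the chain is total. The square for \<open>h\<close>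
  then already holds at stage \<open>k\<close>.\<close>

lemma colimit_algebra:
  assumes lim: "\<And>i. i \<in> Field \<kappa> \<Longrightarrow> \<exists>k. i \<prec> k" and ne: "Field \<kappa> \<noteq> {}"
    and Y: "preorder_colimit C \<kappa> (\<lambda>i. Carrier (s i)) (connect s) Y \<tau>"
    and GY: "preorder_colimit C \<kappa> (\<lambda>i. FO G (Carrier (s i))) (\<lambda>j k. FA G (connect s j k))
      (FO G Y) (\<lambda>i. FA G (\<tau> i))"
  obtains \<zeta> h where "\<zeta> \<in> Hom C (FO G Y) Y" "h \<in> Hom C X Y"
    "\<And>i. i \<in> Field \<kappa> \<Longrightarrow> h = \<tau> i \<cdot> Base (s i)"
    "\<And>j k. j \<prec> k \<Longrightarrow> \<zeta> \<cdot> FA G (\<tau> j) = \<tau> k \<cdot> Leg (s k) j"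
    "h \<cdot> \<xi> = \<zeta> \<cdot> FA G h \<cdot> a"
proof -
  have YO: "Y \<in> Obj C" and \<tau>: "\<And>i. i \<in> Field \<kappa> \<Longrightarrow> \<tau> i \<in> Hom C (Carrier (s i)) Y"
    and \<tau>c: "\<And>j k. j \<preceq> k \<Longrightarrow> \<tau> k \<cdot> connect s j k = \<tau> j"
    using Y by (auto simp: preorder_colimit_def preorder_cocone_def)
  have \<tau>L: "\<tau> k' \<cdot> Leg (s k') j = \<tau> k \<cdot> Leg (s k) j" if jk: "j \<prec> k" and kk: "k \<preceq> k'" for j k k'
    using assoc[OF s_Leg[OF jk] s_Hom[OF kk] \<tau>[OF FieldI2[OF kk]]] s_connect_Leg[OF kk jk] \<tau>c[OF kk]
    by simp
  have \<tau>L': "\<tau> k' \<cdot> Leg (s k') j = \<tau> k \<cdot> Leg (s k) j" if "j \<prec> k" "j \<prec> k'" for j k k'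
  proof -
    have "k \<in> Field \<kappa>" "k' \<in> Field \<kappa>" using that by (auto intro: FieldI2)
    then show ?thesis using upto_total[of k k'] \<tau>L[of j k k'] \<tau>L[of j k' k] that by auto
  qed
  have \<tau>B: "\<tau> k \<cdot> Base (s k) = \<tau> j \<cdot> Base (s j)" if jk: "j \<preceq> k" for j k
    using assoc[OF s_Base s_Hom[OF jk] \<tau>[OF FieldI2[OF jk]]] s_connect_Base[OF jk] \<tau>c[OF jk] by simp
  define w where "w j = \<tau> (SOME k. j \<prec> k) \<cdot> Leg (s (SOME k. j \<prec> k)) j" for j
  have w: "w j = \<tau> k \<cdot> Leg (s k) j" if "j \<prec> k" for j k
    unfolding w_def by (rule \<tau>L'[OF that]) (rule someI[of "\<lambda>k. j \<prec> k", OF that])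
  have wH: "w j \<in> Hom C (FO G (Carrier (s j))) Y" if j: "j \<in> Field \<kappa>" for j
  proof -
    obtain k where k: "j \<prec> k" using lim[OF j] by blast
    have "k \<in> Field \<kappa>" using k by (auto intro: FieldI2)
    then show ?thesis using Comp_Hom[OF s_Leg[OF k] \<tau>] w[OF k] by simp
  qed
  have wc: "w k \<cdot> FA G (connect s j k) = w j" if jk: "j \<preceq> k" for j k
  proof (cases "j = k")
    case True
    have "k \<in> Field \<kappa>" using FieldI2[OF jk] .
    then show ?thesis using True connect_self[OF univ] G_Id[OF s_Obj] Comp_Id[OF wH] by simp
  next
    case False
    obtain l where l: "k \<prec> l" using lim[OF FieldI2[OF jk]] by blast
    have jl: "j \<prec> l" using upto_below_trans[OF jk l] .
    have "Leg (s l) k \<cdot> FA G (connect s j k) = Leg (s l) j"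
      using universal_compat[OF univ, of l] l jk False unfolding compat_def by blast
    moreover have "l \<in> Field \<kappa>" using l by (auto intro: FieldI2)
    ultimately show ?thesis
      using assoc[OF G_Hom[OF s_Hom[OF jk]] s_Leg[OF l] \<tau>] w[OF l] w[OF jl] by simp
  qed
  have "preorder_cocone C \<kappa> (\<lambda>i. FO G (Carrier (s i))) (\<lambda>j k. FA G (connect s j k)) Y w"
    unfolding preorder_cocone_def using YO wH wc by blast
  then obtain \<zeta> where \<zeta>: "\<zeta> \<in> Hom C (FO G Y) Y"
    and \<zeta>\<tau>: "\<And>j. j \<in> Field \<kappa> \<Longrightarrow> \<zeta> \<cdot> FA G (\<tau> j) = w j"
    using GY unfolding preorder_colimit_def by blast
  obtain i where i: "i \<in> Field \<kappa>" using ne by blast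
  define h where "h = \<tau> i \<cdot> Base (s i)"
  have hH: "h \<in> Hom C X Y" using Comp_Hom[OF s_Base \<tau>[OF i]] by (simp add: h_def)
  have hB: "h = \<tau> j \<cdot> Base (s j)" if "j \<in> Field \<kappa>" for j
    using upto_total[OF i that] \<tau>B[of i j] \<tau>B[of j i] by (auto simp: h_def)
  obtain k where k: "i \<prec> k" using lim[OF i] by blast
  have kF: "k \<in> Field \<kappa>" using k by (auto intro: FieldI2)
  note GB = G_Hom[OF s_Base[of i]] and G\<tau> = G_Hom[OF \<tau>[OF i]]
  have "h \<cdot> \<xi> = \<tau> k \<cdot> Base (s k) \<cdot> \<xi>"
    using assoc[OF \<xi> s_Base \<tau>[OF kF]] hB[OF kF] by simp
  also have "\<dots> = \<tau> k \<cdot> Leg (s k) i \<cdot> FA G (Base (s i)) \<cdot> a"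
    using universal_compat[OF univ, of k] k by (simp add: compat_def)
  also have "\<dots> = w i \<cdot> FA G (Base (s i)) \<cdot> a"
    using assoc[OF Comp_Hom[OF a GB] s_Leg[OF k] \<tau>[OF kF]] w[OF k] by simp
  also have "\<dots> = \<zeta> \<cdot> FA G (\<tau> i) \<cdot> FA G (Base (s i)) \<cdot> a"
    using assoc[OF Comp_Hom[OF a GB] G\<tau> \<zeta>] \<zeta>\<tau>[OF i] by simp
  also have "\<dots> = \<zeta> \<cdot> FA G h \<cdot> a"
    using assoc[OF a GB G\<tau>] G_Comp[OF s_Base \<tau>[OF i]] by (simp add: h_def)
  finally have "h \<cdot> \<xi> = \<zeta> \<cdot> FA G h \<cdot> a" .
  moreover have "\<zeta> \<cdot> FA G (\<tau> j) = \<tau> k \<cdot> Leg (s k) j" if "j \<prec> k" for j k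
  proof -
    have "j \<in> Field \<kappa>" using that by (auto intro: FieldI1)
    then show ?thesis using \<zeta>\<tau> w[OF that] by simp
  qed
  ultimately show thesis using that \<zeta> hH hB by blast
qed

text \<open>Algebra morphisms \<open>Y \<rightarrow> Z\<close> extending \<open>g\<close> correspond to solutions of the recursion for the arrows
  \<open>Y\<^sub>i \<rightarrow> Z\<close>, which has exactly one solution. That the resulting arrow respects the algebra
  structures is tested on the colimit \<open>G Y\<close> of the objects \<open>G Y\<^sub>j\<close>.\<close>

lemma colimit_algebra_universal:
  assumes lim: "\<And>i. i \<in> Field \<kappa> \<Longrightarrow> \<exists>k. i \<prec> k" and ne: "Field \<kappa> \<noteq> {}"
    and Y: "preorder_colimit C \<kappa> (\<lambda>i. Carrier (s i)) (connect s) Y \<tau>"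
    and GY: "preorder_colimit C \<kappa> (\<lambda>i. FO G (Carrier (s i))) (\<lambda>j k. FA G (connect s j k))
      (FO G Y) (\<lambda>i. FA G (\<tau> i))"
    and \<zeta>: "\<zeta> \<in> Hom C (FO G Y) Y" and h: "h \<in> Hom C X Y"
    and hB: "\<And>i. i \<in> Field \<kappa> \<Longrightarrow> h = \<tau> i \<cdot> Base (s i)"
    and \<zeta>L: "\<And>j k. j \<prec> k \<Longrightarrow> \<zeta> \<cdot> FA G (\<tau> j) = \<tau> k \<cdot> Leg (s k) j"
    and Z: "Z \<in> Obj C" and \<theta>: "\<theta> \<in> Hom C (FO G Z) Z" and g: "g \<in> Hom C X Z"
    and sq: "g \<cdot> \<xi> = \<theta> \<cdot> FA G g \<cdot> a"
  shows "\<exists>!f. f \<in> Hom C Y Z \<and> f \<cdot> \<zeta> = \<theta> \<cdot> FA G f \<and> f \<cdot> h = g"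
proof -
  obtain d where d: "\<And>i. mediates (s i) i Z g (\<lambda>l. \<theta> \<cdot> FA G (d l)) (d i)"
    using ex_maps_to_algebra[OF Z \<theta> g sq] by blast
  have comp: "compat s i Z g (\<lambda>l. \<theta> \<cdot> FA G (d l))" for i
    using compat_algebra[OF Z \<theta> g sq d] .
  have dH: "d i \<in> Hom C (Carrier (s i)) Z" and dB: "d i \<cdot> Base (s i) = g"
    and dL: "\<And>j. j \<prec> i \<Longrightarrow> d i \<cdot> Leg (s i) j = \<theta> \<cdot> FA G (d j)" for i
    using d[of i] by (simp_all add: mediates_def)
  have dc: "d k \<cdot> connect s j k = d j" if "j \<preceq> k" for j k
    using mediates_unique[OF univ comp mediates_comp_connect[OF univ univ that d] d] .
  have \<tau>: "\<And>i. i \<in> Field \<kappa> \<Longrightarrow> \<tau> i \<in> Hom C (Carrier (s i)) Y"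
    using Y by (auto simp: preorder_colimit_def preorder_cocone_def)
  have "preorder_cocone C \<kappa> (\<lambda>i. Carrier (s i)) (connect s) Z d"
    unfolding preorder_cocone_def using Z dH dc by blast
  then obtain f where f: "f \<in> Hom C Y Z" and f\<tau>: "\<And>i. i \<in> Field \<kappa> \<Longrightarrow> f \<cdot> \<tau> i = d i"
    using Y unfolding preorder_colimit_def by blast
  obtain i\<^sub>0 where i\<^sub>0: "i\<^sub>0 \<in> Field \<kappa>" using ne by blast
  have fh: "f \<cdot> h = g"
    using assoc[OF s_Base \<tau>[OF i\<^sub>0] f] hB[OF i\<^sub>0] f\<tau>[OF i\<^sub>0] dB by simp
  have "f \<cdot> \<zeta> = \<theta> \<cdot> FA G f"
  proof (rule preorder_colimit_eqI[OF category_axioms chain_diagram_image GY])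
    show "f \<cdot> \<zeta> \<in> Hom C (FO G Y) Z" "\<theta> \<cdot> FA G f \<in> Hom C (FO G Y) Z"
      using Comp_Hom[OF \<zeta> f] Comp_Hom[OF G_Hom[OF f] \<theta>] .
    fix j assume j: "j \<in> Field \<kappa>"
    obtain k where k: "j \<prec> k" using lim[OF j] by blast
    have kF: "k \<in> Field \<kappa>" using k by (auto intro: FieldI2)
    note G\<tau> = G_Hom[OF \<tau>[OF j]]
    have "(f \<cdot> \<zeta>) \<cdot> FA G (\<tau> j) = f \<cdot> \<tau> k \<cdot> Leg (s k) j"
      using assoc[OF G\<tau> \<zeta> f] \<zeta>L[OF k] by simp
    also have "\<dots> = d k \<cdot> Leg (s k) j"
      using assoc[OF s_Leg[OF k] \<tau>[OF kF] f] f\<tau>[OF kF] by simp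
    also have "\<dots> = \<theta> \<cdot> FA G (f \<cdot> \<tau> j)" using dL[OF k] f\<tau>[OF j] by simp
    also have "\<dots> = (\<theta> \<cdot> FA G f) \<cdot> FA G (\<tau> j)"
      using assoc[OF G\<tau> G_Hom[OF f] \<theta>] G_Comp[OF \<tau>[OF j] f] by simp
    finally show "(f \<cdot> \<zeta>) \<cdot> FA G (\<tau> j) = (\<theta> \<cdot> FA G f) \<cdot> FA G (\<tau> j)" .
  qed
  moreover have "f' = f" if f': "f' \<in> Hom C Y Z" "f' \<cdot> \<zeta> = \<theta> \<cdot> FA G f'" "f' \<cdot> h = g" for f'
  proof (rule preorder_colimit_eqI[OF category_axioms chain_diagram Y f'(1) f])
    have "f' \<cdot> \<tau> i = d i" if "i \<in> Field \<kappa>" for i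
      using wf_less that
    proof (induction i)
      case (less i)
      note \<tau>i = \<tau>[OF less.prems]
      have "(f' \<cdot> \<tau> i) \<cdot> Leg (s i) j = \<theta> \<cdot> FA G (d j)" if j: "j \<prec> i" for j
      proof -
        have jF: "j \<in> Field \<kappa>" using j by (auto intro: FieldI1)
        have "(f' \<cdot> \<tau> i) \<cdot> Leg (s i) j = f' \<cdot> \<zeta> \<cdot> FA G (\<tau> j)"
          using assoc[OF s_Leg[OF j] \<tau>i f'(1)] \<zeta>L[OF j] by simp
        also have "\<dots> = (\<theta> \<cdot> FA G f') \<cdot> FA G (\<tau> j)"
          using assoc[OF G_Hom[OF \<tau>[OF jF]] \<zeta> f'(1)] f'(2) by simp
        also have "\<dots> = \<theta> \<cdot> FA G (f' \<cdot> \<tau> j)"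
          using assoc[OF G_Hom[OF \<tau>[OF jF]] G_Hom[OF f'(1)] \<theta>] G_Comp[OF \<tau>[OF jF] f'(1)] by simp
        finally show ?thesis using less.IH[OF j jF] by simp
      qed
      then have "mediates (s i) i Z g (\<lambda>l. \<theta> \<cdot> FA G (d l)) (f' \<cdot> \<tau> i)"
        unfolding mediates_def
        using Comp_Hom[OF \<tau>i f'(1)] assoc[OF s_Base \<tau>i f'(1)] hB[OF less.prems] f'(3) by simp
      then show ?case using mediates_unique[OF univ comp _ d] by simp
    qed
    then show "f' \<cdot> \<tau> i = f \<cdot> \<tau> i" if "i \<in> Field \<kappa>" for i
      using f\<tau> that by simp
  qed
  ultimately show ?thesis using f fh by blast
qed

end

end

text \<open>With a universal such algebra for \<open>A\<close> initial one gets the free \<open>G\<close>-algebra on \<open>X\<close>; the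
  application to reindexing takes \<open>A = F X\<close> and \<open>a = \<alpha>\<^sub>X\<close>.\<close>

theorem ex_universal_algebra:
  fixes U :: "'u rel" and \<kappa> :: "'k rel" and C :: "('o, 'a) cat"
  assumes U: "Card_order U" and \<kappa>: "Cinfinite \<kappa>" "regularCard \<kappa>" and \<kappa>U: "\<kappa> <o U"
    and cat: "category C" and coc: "cocomplete U C" and G: "accessible_functor U \<kappa> C C G"
    and \<xi>: "\<xi> \<in> Hom C A X" and a: "a \<in> Hom C A (FO G X)"
  obtains Y \<zeta> h where "Y \<in> Obj C" "\<zeta> \<in> Hom C (FO G Y) Y" "h \<in> Hom C X Y"
    "Comp C h \<xi> = Comp C \<zeta> (Comp C (FA G h) a)"
    "\<And>Z \<theta> g. Z \<in> Obj C \<Longrightarrow> \<theta> \<in> Hom C (FO G Z) Z \<Longrightarrow> g \<in> Hom C X Z \<Longrightarrow>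
      Comp C g \<xi> = Comp C \<theta> (Comp C (FA G g) a) \<Longrightarrow>
      \<exists>!f. f \<in> Hom C Y Z \<and> Comp C f \<zeta> = Comp C \<theta> (FA G f) \<and> Comp C f h = g"
proof -
  have co: "Card_order \<kappa>" and inf: "infinite (Field \<kappa>)"
    using \<kappa>(1) by (auto simp: cinfinite_def)
  have wo: "Well_order \<kappa>" using co by (simp add: card_order_on_well_order_on)
  interpret partial_algebra C \<kappa> G A X \<xi> a
    using cat wo G \<xi> a
    by (simp add: partial_algebra_def partial_algebra_axioms_def accessible_functor_def)
  have F\<kappa>: "|Field \<kappa>| <o U"
    using card_of_least[OF wo] \<kappa>U ordLeq_ordLess_trans by blast
  have Uinf: "infinite (Field U)"
  proof
    assume "finite (Field U)"
    have "|Field \<kappa>| \<le>o |Field U|"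
      using ordLess_imp_ordLeq[OF F\<kappa>] ordIso_symmetric[OF card_of_Field_ordIso[OF U]]
        ordLeq_ordIso_trans by blast
    with \<open>finite (Field U)\<close> inf show False using card_of_ordLeq_finite by blast
  qed
  obtain s where s: "\<And>i. universal s i (s i)"
    using ex_chain[OF U Uinf coc \<kappa>U] by blast
  \<comment> \<open>Regularity enters here: fewer than \<open>\<kappa>\<close> indices are not cofinal, hence bounded.\<close>
  have ub: "\<exists>b\<in>Field \<kappa>. \<forall>p\<in>K. p \<preceq> b" if K: "K \<subseteq> Field \<kappa>" "|K| <o \<kappa>" for K
  proof -
    have "\<not> cofinal K \<kappa>"
      using \<kappa>(2) K not_ordLess_ordIso unfolding regularCard_def by blast
    then obtain b where b: "b \<in> Field \<kappa>" "\<And>p. p \<in> K \<Longrightarrow> b = p \<or> (b, p) \<notin> \<kappa>"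
      unfolding cofinal_def by blast
    have "p \<preceq> b" if "p \<in> K" for p
      using b(2)[OF that] upto_total[of p b] upto_refl b(1) K(1) that by auto
    with b(1) show ?thesis by blast
  qed
  note diag = chain_diagram[OF s]
  obtain Y \<tau> where Y: "preorder_colimit C \<kappa> (\<lambda>i. Carrier (s i)) (connect s) Y \<tau>"
    using ex_preorder_colimit[OF U Uinf coc diag F\<kappa>] by blast
  note GY = accessible_functor_preorder_colimit[OF U Uinf G diag F\<kappa> ub Y]
  have lim: "\<exists>k. i \<prec> k" if "i \<in> Field \<kappa>" for i
    using infinite_Card_order_limit[OF co inf that] by blast
  have ne: "Field \<kappa> \<noteq> {}" using inf by auto
  from colimit_algebra[OF s lim ne Y GY] obtain \<zeta> h where
    1: "\<zeta> \<in> Hom C (FO G Y) Y" "h \<in> Hom C X Y"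
    "\<And>i. i \<in> Field \<kappa> \<Longrightarrow> h = \<tau> i \<cdot> Base (s i)"
    "\<And>j k. j \<prec> k \<Longrightarrow> \<zeta> \<cdot> FA G (\<tau> j) = \<tau> k \<cdot> Leg (s k) j"
    and 2: "h \<cdot> \<xi> = \<zeta> \<cdot> FA G h \<cdot> a" by blast
  show thesis
    by (rule that[OF Hom_Obj(2)[OF 1(2)] 1(1,2) 2 colimit_algebra_universal[OF s lim ne Y GY 1]])
qed

section \<open>The left adjoint of reindexing\<close>

theorem theorem4p4:
  fixes U :: "'u rel" and \<kappa> :: "'k rel"
    and \<X> :: "('o, 'a) cat"
    and F G :: "('o, 'a, 'o, 'a) fctr" and \<alpha> :: "'o \<Rightarrow> 'a"
  assumes "Card_order U"
    and "Cinfinite \<kappa>" and "regularCard \<kappa>" and "\<kappa> <o U"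
    and "locally_presentable U \<kappa> \<X>"
    and "accessible_functor U \<kappa> \<X> \<X> F"
    and "accessible_functor U \<kappa> \<X> \<X> G"
    and "nat_trans \<X> \<X> F G \<alpha>"
  shows "has_left_adjoint (Alg \<X> G) (Alg \<X> F) (reindex \<X> \<alpha>)"
proof (rule left_adjoint_from_universal_arrows[OF functor_reindex[OF assms(8)]])
  have cat: "category \<X>" and coc: "cocomplete U \<X>"
    using assms(5) by (auto simp: locally_presentable_def)
  interpret category \<X> by fact
  have \<alpha>: "\<And>x. x \<in> Obj \<X> \<Longrightarrow> \<alpha> x \<in> Hom \<X> (FO F x) (FO G x)"
    "\<And>x y f. f \<in> Hom \<X> x y \<Longrightarrow> Comp \<X> (\<alpha> y) (FA F f) = Comp \<X> (FA G f) (\<alpha> x)"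
    using assms(8) by (auto simp: nat_trans_def)
  have FH: "\<And>x y f. f \<in> Hom \<X> x y \<Longrightarrow> FA F f \<in> Hom \<X> (FO F x) (FO F y)"
    using assms(8) by (simp add: nat_trans_def is_functor_def)
  fix A assume "A \<in> Obj (Alg \<X> F)"
  then obtain X \<xi> where A: "A = (X, \<xi>)" and X: "X \<in> Obj \<X>" and \<xi>: "\<xi> \<in> Hom \<X> (FO F X) X"
    by (auto simp: Alg_def)
  obtain Y \<zeta> h where Y: "Y \<in> Obj \<X>" and \<zeta>: "\<zeta> \<in> Hom \<X> (FO G Y) Y" and h: "h \<in> Hom \<X> X Y"
    and sq: "Comp \<X> h \<xi> = Comp \<X> \<zeta> (Comp \<X> (FA G h) (\<alpha> X))"
    and univ: "\<And>Z \<theta> g. Z \<in> Obj \<X> \<Longrightarrow> \<theta> \<in> Hom \<X> (FO G Z) Z \<Longrightarrow> g \<in> Hom \<X> X Z \<Longrightarrow>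
      Comp \<X> g \<xi> = Comp \<X> \<theta> (Comp \<X> (FA G g) (\<alpha> X)) \<Longrightarrow>
      \<exists>!f. f \<in> Hom \<X> Y Z \<and> Comp \<X> f \<zeta> = Comp \<X> \<theta> (FA G f) \<and> Comp \<X> f h = g"
    by (rule ex_universal_algebra[OF assms(1-4) cat coc assms(7) \<xi> \<alpha>(1)[OF X]]) (rule that)
  have hom: "Comp \<X> (Comp \<X> \<theta> (\<alpha> Z)) (FA F g) = Comp \<X> \<theta> (Comp \<X> (FA G g) (\<alpha> X))"
    if "Z \<in> Obj \<X>" "\<theta> \<in> Hom \<X> (FO G Z) Z" "g \<in> Hom \<X> X Z" for Z \<theta> g
    using Comp_assoc[OF FH[OF that(3)] \<alpha>(1)[OF that(1)] that(2)] \<alpha>(2)[OF that(3)] by simp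
  let ?L = "(Y, \<zeta>)"
  let ?e = "(A, h, reindex_obj \<X> \<alpha> ?L)"
  have ob: "?L \<in> Obj (Alg \<X> G)" using Y \<zeta> by (simp add: Alg_def)
  have e: "?e \<in> Hom (Alg \<X> F) A (FO (reindex \<X> \<alpha>) ?L)"
    using X \<xi> Y h sq hom[OF Y \<zeta> h] Comp_Hom[OF \<alpha>(1)[OF Y] \<zeta>]
    by (simp add: A reindex_def reindex_obj_def Hom_Alg)
  have "\<exists>!k. k \<in> Hom (Alg \<X> G) ?L B \<and> Comp (Alg \<X> F) (FA (reindex \<X> \<alpha>) k) ?e = m"
    if B: "B \<in> Obj (Alg \<X> G)" and m: "m \<in> Hom (Alg \<X> F) A (FO (reindex \<X> \<alpha>) B)" for B m
  proof -
    obtain Z \<theta> where BZ: "B = (Z, \<theta>)" and Z: "Z \<in> Obj \<X>" and \<theta>: "\<theta> \<in> Hom \<X> (FO G Z) Z"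
      using B by (auto simp: Alg_def)
    obtain g where mg: "m = (A, g, reindex_obj \<X> \<alpha> B)" and g: "g \<in> Hom \<X> X Z"
      and gsq: "Comp \<X> g \<xi> = Comp \<X> (Comp \<X> \<theta> (\<alpha> Z)) (FA F g)"
      using m by (auto simp: A BZ reindex_def reindex_obj_def Hom_Alg)
    \<comment> \<open>Arrows of algebras carry their ends, so they correspond to their underlying arrows only once
        both ends are given.\<close>
    have H: "k \<in> Hom (Alg \<X> G) ?L B \<longleftrightarrow>
        (\<exists>f. k = (?L, f, B) \<and> f \<in> Hom \<X> Y Z \<and> Comp \<X> f \<zeta> = Comp \<X> \<theta> (FA G f))" for k
      using Y \<zeta> Z \<theta> by (auto simp: BZ Hom_Alg)
    have K: "Comp (Alg \<X> F) (FA (reindex \<X> \<alpha>) (?L, f, B)) ?e = m \<longleftrightarrow> Comp \<X> f h = g" for f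
      by (simp add: Alg_def reindex_def mg)
    have "\<exists>!f. f \<in> Hom \<X> Y Z \<and> Comp \<X> f \<zeta> = Comp \<X> \<theta> (FA G f) \<and> Comp \<X> f h = g"
      using univ[OF Z \<theta> g] gsq hom[OF Z \<theta> g] by simp
    then obtain f where f: "f \<in> Hom \<X> Y Z" "Comp \<X> f \<zeta> = Comp \<X> \<theta> (FA G f)" "Comp \<X> f h = g"
      and un: "\<And>f'. f' \<in> Hom \<X> Y Z \<Longrightarrow> Comp \<X> f' \<zeta> = Comp \<X> \<theta> (FA G f') \<Longrightarrow> Comp \<X> f' h = g \<Longrightarrow> f' = f"
      by blast
    show ?thesis
    proof (rule ex1I[of _ "(?L, f, B)"])
      show "(?L, f, B) \<in> Hom (Alg \<X> G) ?L B \<and>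
          Comp (Alg \<X> F) (FA (reindex \<X> \<alpha>) (?L, f, B)) ?e = m"
        using f H K by blast
      fix k assume k: "k \<in> Hom (Alg \<X> G) ?L B \<and> Comp (Alg \<X> F) (FA (reindex \<X> \<alpha>) k) ?e = m"
      then obtain f' where f': "k = (?L, f', B)" "f' \<in> Hom \<X> Y Z" "Comp \<X> f' \<zeta> = Comp \<X> \<theta> (FA G f')"
        using H by blast
      moreover have "Comp \<X> f' h = g" using k K f'(1) by blast
      ultimately show "k = (?L, f, B)" using un by simp
    qed
  qed
  with ob e show "\<exists>l e. l \<in> Obj (Alg \<X> G) \<and> e \<in> Hom (Alg \<X> F) A (FO (reindex \<X> \<alpha>) l) \<and>
      (\<forall>y\<in>Obj (Alg \<X> G). \<forall>f\<in>Hom (Alg \<X> F) A (FO (reindex \<X> \<alpha>) y).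
        \<exists>!g. g \<in> Hom (Alg \<X> G) l y \<and> Comp (Alg \<X> F) (FA (reindex \<X> \<alpha>) g) e = f)"
    by blast
qed

end
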